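(* Let $A\in\mathbb{R}^{n\times d}$ be a nonzero matrix, $b\in\mathbb{R}^n$ and $T\in\mathbb{N}$. Let $\mathcal{T}$ be a $(\overline{p},\overline{\alpha},\overline{\beta})$ column paving of $A$ and let $\mathcal{S}$ be a $(p,\alpha,\beta)$ row paving of $A$ with $\alpha>0$. Let $x_T$ be the output of the Randomized Double Block Kaczmarz Least Squares Solver (described in the context) run for $T$ iterations on input $A,b$ with column partition $\mathcal{T}$ and row partition $\mathcal{S}$. Then $$\mathbb{E}\|x_T-x_{LS}\|_2^2\le \gamma^T\|x_0-x_{LS}\|_2^2+\left(\gamma^{\lfloor T/2\rfloor}+\overline{\gamma}^{\lfloor T/2\rfloor}\right)\frac{\|b_{\mathcal{R}(A)}\|_2^2}{\alpha(1-\gamma)},$$ where $\gamma=1-\frac{\sigma_{\min}^2(A)}{p\beta}$ and $\overline{\gamma}=1-\frac{\sigma_{\min}^2(A)}{\overline{p}\,\overline{\beta}}$.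
   Context: Notation: $A^\dagger$ is the Moore-Penrose pseudoinverse; $x_{LS}=A^\dagger b$; $b_{\mathcal{R}(A)}=AA^\dagger b$ is the orthogonal projection of $b$ onto the range of $A$; $\sigma_{\min}(A)$ is the smallest nonzero singular value of $A$. No full-rank assumption is made on $A$. Row paving: a $(p,\alpha,\beta)$ row paving of an $n\times d$ matrix $A$ is a partition $\{\upsilon_1,\dots,\upsilon_p\}$ of the row index set $[n]=\{1,\dots,n\}$ into $p$ nonempty blocks such that for each block $\upsilon$, $\alpha\le\lambda_{\min}(A_\upsilon A_\upsilon^* )$ and $\lambda_{\max}(A_\upsilon A_\upsilon^* )\le\beta$, where $A_\upsilon$ is the $|\upsilon|\times d$ submatrix of $A$ with rows indexed by $\upsilon$. A column paving of $A$ is a row paving of $A^*$ (so a partition of the column index set $[d]$). Randomized Double Block Kaczmarz Least Squares Solver: given a column partition $\mathcal{T}$ of $[d]$ and a row partition $\mathcal{S}$ of $[n]$, set $x_0=0\in\mathbb{R}^d$ and $z_0=b$. For $k=1,2,\dots,T$: pick $\tau_k\in\mathcal{T}$ and $\upsilon_k\in\mathcal{S}$ uniformly at random (all picks independent), and set $$z_k=z_{k-1}-A_{\tau_k}(A_{\tau_k})^\dagger z_{k-1},\qquad x_k=x_{k-1}+(A_{\upsilon_k})^\dagger\left(b_{\upsilon_k}-(z_k)_{\upsilon_k}-A_{\upsilon_k}x_{k-1}\right),$$ where $A_{\tau_k}$ is the $n\times|\tau_k|$ submatrix of $A$ with columns indexed by $\tau_k$, $A_{\upsilon_k}$ is the $|\upsilon_k|\times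 d$ submatrix with rows indexed by $\upsilon_k$, and $v_{\upsilon}$ denotes the restriction of a vector $v$ to the coordinates in $\upsilon$. Output $x_T$. The expectation is over all random picks. *)

theory Defs
  imports
    "HOL-Probability.Probability_Mass_Function"
    "Jordan_Normal_Form.Spectral_Radius"
    "Jordan_Normal_Form.DL_Submatrix"
begin

(* Matrices and vectors are those of Jordan_Normal_Form, so index sets are {..<n} and {..<d}
   (0-based) and the blocks A_v are genuine |v| x d or n x |t| matrices. *)

hide_const (open) Finite_Cartesian_Product.vec
hide_type (open) Finite_Cartesian_Product.vec
unbundle no vec_syntax
unbundle no inner_syntax

definition l2norm :: "real vec \<Rightarrow> real" where
  "l2norm v = sqrt (v \<bullet> v)"

definition rows_of :: "real mat \<Rightarrow> nat set \<Rightarrow> real mat" where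
  "rows_of A I = submatrix A I UNIV"

definition cols_of :: "real mat \<Rightarrow> nat set \<Rightarrow> real mat" where
  "cols_of A J = submatrix A UNIV J"

(* pick enumerates the index set increasingly, consistently with submatrix. *)
definition subvec :: "real vec \<Rightarrow> nat set \<Rightarrow> real vec" where
  "subvec v I = vec (card {i. i < dim_vec v \<and> i \<in> I}) (\<lambda>i. v $ pick I i)"

definition is_pinv :: "real mat \<Rightarrow> real mat \<Rightarrow> bool" where
  "is_pinv A X \<longleftrightarrow>
     X \<in> carrier_mat (dim_col A) (dim_row A) \<and>
     A * X * A = A \<and> X * A * X = X \<and>
     transpose_mat (A * X) = A * X \<and> transpose_mat (X * A) = X * A"

lemma is_pinv_unique:
  assumes "is_pinv A X" "is_pinv A Y"
  shows "X = Y"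
proof -
  define n d where "n = dim_row A" and "d = dim_col A"
  have A: "A \<in> carrier_mat n d" by (simp add: n_def d_def)
  have X: "X \<in> carrier_mat d n" and Y: "Y \<in> carrier_mat d n"
    using assms by (auto simp: is_pinv_def n_def d_def)
  note AX = mult_carrier_mat[OF A X] and AY = mult_carrier_mat[OF A Y]
  note XA = mult_carrier_mat[OF X A] and YA = mult_carrier_mat[OF Y A]
  have "A * X = (A * Y) * (A * X)"
    using assms assoc_mult_mat[OF AY A X] by (simp add: is_pinv_def)
  also have "\<dots> = transpose_mat ((A * X) * (A * Y))"
    using assms transpose_mult[OF AX AY] by (simp add: is_pinv_def)
  also have "(A * X) * (A * Y) = A * Y"
    using assms assoc_mult_mat[OF AX A Y] by (simp add: is_pinv_def)
  finally have 1: "A * X = A * Y" using assms by (simp add: is_pinv_def)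
  have "X * A = (X * A) * (Y * A)"
    using assms assoc_mult_mat[OF X A YA] assoc_mult_mat[OF A Y A] by (simp add: is_pinv_def)
  also have "\<dots> = transpose_mat ((Y * A) * (X * A))"
    using assms transpose_mult[OF YA XA] by (simp add: is_pinv_def)
  also have "(Y * A) * (X * A) = Y * A"
    using assms assoc_mult_mat[OF Y A XA] assoc_mult_mat[OF A X A] by (simp add: is_pinv_def)
  finally have 2: "X * A = Y * A" using assms by (simp add: is_pinv_def)
  have "X = X * A * X" using assms by (simp add: is_pinv_def)
  also have "\<dots> = Y * (A * X)" using 2 assoc_mult_mat[OF Y A X] by simp
  also have "\<dots> = Y * A * Y" using 1 assoc_mult_mat[OF Y A Y] by simp
  also have "\<dots> = Y" using assms by (simp add: is_pinv_def)
  finally show ?thesis .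
qed

definition pinv :: "real mat \<Rightarrow> real mat" where
  "pinv A = (THE X. is_pinv A X)"

definition lambda_min :: "real mat \<Rightarrow> real" where
  "lambda_min M = Min (spectrum M)"

definition lambda_max :: "real mat \<Rightarrow> real" where
  "lambda_max M = Max (spectrum M)"

definition singular_values :: "real mat \<Rightarrow> real set" where
  "singular_values A = sqrt ` spectrum (transpose_mat A * A)"

definition sigma_min :: "real mat \<Rightarrow> real" where
  "sigma_min A = Min (singular_values A - {0})"

definition row_paving :: "real mat \<Rightarrow> nat \<Rightarrow> real \<Rightarrow> real \<Rightarrow> nat set set \<Rightarrow> bool" where
  "row_paving A p \<alpha> \<beta> \<S> \<longleftrightarrow>
     partition_on {..<dim_row A} \<S> \<and> card \<S> = p \<and>
     (\<forall>\<upsilon>\<in>\<S>. \<alpha> \<le> lambda_min (rows_of A \<upsilon> * transpose_mat (rows_of A \<upsilon>)) \<and>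
            lambda_max (rows_of A \<upsilon> * transpose_mat (rows_of A \<upsilon>)) \<le> \<beta>)"

definition col_paving :: "real mat \<Rightarrow> nat \<Rightarrow> real \<Rightarrow> real \<Rightarrow> nat set set \<Rightarrow> bool" where
  "col_paving A p \<alpha> \<beta> \<T> \<longleftrightarrow> row_paving (transpose_mat A) p \<alpha> \<beta> \<T>"

definition z_step :: "real mat \<Rightarrow> nat set \<Rightarrow> real vec \<Rightarrow> real vec" where
  "z_step A \<tau> z = z - cols_of A \<tau> *\<^sub>v (pinv (cols_of A \<tau>) *\<^sub>v z)"

definition x_step :: "real mat \<Rightarrow> real vec \<Rightarrow> nat set \<Rightarrow> real vec \<Rightarrow> real vec \<Rightarrow> real vec" where
  "x_step A b \<upsilon> z x =
     x + pinv (rows_of A \<upsilon>) *\<^sub>v (subvec b \<upsilon> - subvec z \<upsilon> - rows_of A \<upsilon> *\<^sub>v x)"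

(* Joint law of (x_k, z_k); the fresh draws in each bind make all picks independent. *)
primrec rdbk_state ::
  "real mat \<Rightarrow> real vec \<Rightarrow> nat set set \<Rightarrow> nat set set \<Rightarrow> nat \<Rightarrow> (real vec \<times> real vec) pmf" where
  "rdbk_state A b \<T> \<S> 0 = return_pmf (0\<^sub>v (dim_col A), b)"
| "rdbk_state A b \<T> \<S> (Suc k) =
     bind_pmf (rdbk_state A b \<T> \<S> k) (\<lambda>(x, z).
     bind_pmf (pmf_of_set \<T>) (\<lambda>\<tau>.
     bind_pmf (pmf_of_set \<S>) (\<lambda>\<upsilon>.
       let z' = z_step A \<tau> z in return_pmf (x_step A b \<upsilon> z' x, z'))))"

definition rdbk :: "real mat \<Rightarrow> real vec \<Rightarrow> nat set set \<Rightarrow> nat set set \<Rightarrow> nat \<Rightarrow> real vec pmf" where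
  "rdbk A b \<T> \<S> N = map_pmf fst (rdbk_state A b \<T> \<S> N)"

end

theory Submission
  imports Defs
begin

text \<open>
Let \<open>b'\<close> be the component of \<open>b\<close> orthogonal to the range of \<open>A\<close>. Write \<open>z = b' + w\<close> with \<open>w\<close> in the range of \<open>A\<close>, and \<open>e = x - pinv A b\<close>, which stays in the
row space of \<open>A\<close>. A column step replaces \<open>w\<close> by its residual \<open>w - P w\<close>, where \<open>P\<close> projects onto
the span of the chosen columns; averaging over the blocks contracts \<open>\<parallel>w\<parallel>\<^sup>2\<close> by \<open>\<gamma>'\<close>. A row step
replaces \<open>e\<close> by the orthogonal sum of its projection onto the kernel of the chosen rows and a
perturbation coming from \<open>w\<close>, so on average \<open>\<parallel>e\<parallel>\<^sup>2\<close> becomes at most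
\<open>\<gamma> \<parallel>e\<parallel>\<^sup>2 + \<parallel>w\<parallel>\<^sup>2 / \<alpha>\<close>. In the resulting recursion the perturbation is bounded by
its initial size during the first half of the run, where it is damped by the remaining steps, and by
\<open>\<gamma>'\<close> to the power \<open>N div 2\<close> during the second half. All eigenvalue estimates, and the
existence of the pseudoinverse, come from the spectral theorem for real symmetric matrices.
\<close>

section \<open>Spectral theorem for real symmetric matrices\<close>

lemma scalar_prod_transpose:
  fixes A :: "real mat"
  assumes "A \<in> carrier_mat n d" "x \<in> carrier_vec d" "y \<in> carrier_vec n"
  shows "(A *\<^sub>v x) \<bullet> y = x \<bullet> (transpose_mat A *\<^sub>v y)"
  using transpose_vec_mult_scalar[OF assms]
  by (metis assms comm_scalar_prod mult_mat_vec_carrier transpose_carrier_mat)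

text \<open>Conjugating the Hermitian form only exchanges the two summation indices, and the
  symmetry of \<open>M\<close> undoes the exchange. This is the source of the reality of eigenvalues
  below.\<close>

lemma scalar_prod_mat_vec_cnj:
  fixes M :: "real mat" and w :: "complex vec"
  assumes M: "M \<in> carrier_mat n n" and sym: "transpose_mat M = M" and w: "w \<in> carrier_vec n"
  shows "cnj ((map_mat of_real M *\<^sub>v w) \<bullet> conjugate w) = (map_mat of_real M *\<^sub>v w) \<bullet> conjugate w"
proof -
  have s: "M $$ (i,j) = M $$ (j,i)" if "i < n" "j < n" for i j
    using that M sym by (metis carrier_matD index_transpose_mat(1))
  have "(map_mat of_real M *\<^sub>v w) \<bullet> conjugate w = (\<Sum>i<n. (\<Sum>j<n. of_real (M $$ (i,j)) * w $ j) * cnj (w $ i))"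
    using M w by (simp add: scalar_prod_def atLeast0LessThan)
  also have "\<dots> = (\<Sum>i<n. \<Sum>j<n. of_real (M $$ (i,j)) * w $ j * cnj (w $ i))"
    by (simp add: sum_distrib_right)
  finally have 1: "(map_mat of_real M *\<^sub>v w) \<bullet> conjugate w = \<dots>" .
  have "cnj (\<Sum>i<n. \<Sum>j<n. of_real (M $$ (i,j)) * w $ j * cnj (w $ i))
      = (\<Sum>i<n. \<Sum>j<n. of_real (M $$ (i,j)) * cnj (w $ j) * w $ i)" by simp
  also have "\<dots> = (\<Sum>j<n. \<Sum>i<n. of_real (M $$ (i,j)) * cnj (w $ j) * w $ i)"
    by (rule sum.swap)
  also have "\<dots> = (\<Sum>i<n. \<Sum>j<n. of_real (M $$ (i,j)) * w $ j * cnj (w $ i))"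
    by (intro sum.cong refl) (simp add: s)
  finally show ?thesis using 1 by simp
qed

text \<open>Over the complex numbers an eigenvalue exists. It is the quotient of a real quadratic
  form by a squared norm, hence real, and a real root of the complexified characteristic polynomial
  is already a root of the real one.\<close>

lemma symmetric_eigenvalue_exists:
  fixes M :: "real mat"
  assumes M: "M \<in> carrier_mat n n" and sym: "transpose_mat M = M" and n: "n > 0"
  shows "\<exists>e. eigenvalue M e"
proof -
  let ?C = "map_mat of_real M :: complex mat"
  have C: "?C \<in> carrier_mat n n" using M by simp
  from spectrum_non_empty[OF C] n obtain k where k: "eigenvalue ?C k" by (auto simp: spectrum_def)
  then obtain w where w: "w \<in> carrier_vec n" "w \<noteq> 0\<^sub>v n" "?C *\<^sub>v w = k \<cdot>\<^sub>v w"
    using M by (auto simp: eigenvalue_def eigenvector_def)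
  have "(?C *\<^sub>v w) \<bullet> conjugate w = k * (w \<bullet> conjugate w)"
    using w by simp
  moreover have "cnj (w \<bullet> conjugate w) = w \<bullet> conjugate w" using w
    by (simp add: scalar_prod_def mult.commute)
  moreover have "w \<bullet> conjugate w \<noteq> 0"
    using w by simp
  ultimately have "cnj k = k"
    using scalar_prod_mat_vec_cnj[OF M sym w(1)] by simp
  then have kr: "k = of_real (Re k)" by (simp add: complex_eq_iff)
  have "poly (char_poly ?C) k = 0" using eigenvalue_root_char_poly[OF C] k by simp
  then have "poly (map_poly of_real (char_poly M)) (of_real (Re k) :: complex) = 0"
    using kr by (simp add: of_real_hom.char_poly_hom[OF M])
  then have "poly (char_poly M) (Re k) = 0"
    using of_real_hom.poly_map_poly by simp
  then show ?thesis using eigenvalue_root_char_poly[OF M] by blast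
qed

text \<open>Extend \<open>v\<close> to a basis, apply Gram-Schmidt and normalize. Gram-Schmidt keeps
  the first vector, so the first column of \<open>W\<close> is a multiple of
  \<open>v\<close>.\<close>

lemma orthogonal_completion:
  fixes v :: "real vec"
  assumes v: "v \<in> carrier_vec n" "v \<noteq> 0\<^sub>v n"
  shows "\<exists>W c. W \<in> carrier_mat n n \<and> transpose_mat W * W = 1\<^sub>m n \<and> col W 0 = c \<cdot>\<^sub>v v"
proof -
  interpret cof_vec_space n "TYPE(real)" .
  define b where "b = basis_completion v"
  define ws where "ws = gram_schmidt n b"
  note bc = basis_completion[OF v, folded b_def]
  have n0: "n > 0" using v by (cases n) auto
  then obtain vs where bv: "b = v # vs" using bc(6,7) by (cases b) auto
  from gram_schmidt_result[OF bc(2,4,5) refl, folded ws_def] bc(6)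
  have ws: "set ws \<subseteq> carrier_vec n" "corthogonal ws" "length ws = n" by auto
  have hd: "ws ! 0 = v" using gram_schmidt_hd[OF v(1), of vs, folded bv, folded ws_def] ws(3) n0
    by (metis hd_conv_nth length_0_conv less_irrefl)
  define g where "g i = (1 / sqrt (ws ! i \<bullet> ws ! i)) \<cdot>\<^sub>v ws ! i" for i
  define W where "W = mat_of_cols n (map g [0..<n])"
  have wc: "ws ! i \<in> carrier_vec n" if "i < n" for i using ws that by auto
  have W: "W \<in> carrier_mat n n" unfolding W_def by (metis length_map length_upt diff_zero mat_of_cols_carrier(1))
  have colW: "col W i = g i" if "i < n" for i
    unfolding W_def using that wc[OF that] by (subst col_mat_of_cols) (auto simp: g_def)
  have cj: "conjugate u = u" for u :: "real vec" by (intro eq_vecI) auto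
  have orth: "ws ! i \<bullet> ws ! j = 0 \<longleftrightarrow> i \<noteq> j" if "i < n" "j < n" for i j
    using corthogonalD[OF ws(2)] that ws(3) cj by metis
  have "transpose_mat W * W = 1\<^sub>m n"
  proof (rule eq_matI)
    fix i j assume ij: "i < dim_row (1\<^sub>m n)" "j < dim_col (1\<^sub>m n)"
    then have ij: "i < n" "j < n" by auto
    have "(transpose_mat W * W) $$ (i,j) = g i \<bullet> g j"
      using ij W by (simp add: colW)
    also have "\<dots> = (1 / sqrt (ws ! i \<bullet> ws ! i)) * ((1 / sqrt (ws ! j \<bullet> ws ! j)) * (ws ! i \<bullet> ws ! j))"
      unfolding g_def using wc[OF ij(1)] wc[OF ij(2)]
      by (subst smult_scalar_prod_distrib[of _ n]) (auto simp: scalar_prod_smult_distrib[of _ n])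
    also have "\<dots> = 1\<^sub>m n $$ (i,j)"
    proof (cases "i = j")
      case True
      have "ws ! i \<bullet> ws ! i > 0" using orth[OF ij(1) ij(1)]
        by (simp add: scalar_prod_def sum_nonneg order.not_eq_order_implies_strict)
      then show ?thesis using True ij by (simp add: field_simps)
    next
      case False
      then show ?thesis using orth[OF ij] ij by simp
    qed
    finally show "(transpose_mat W * W) $$ (i,j) = 1\<^sub>m n $$ (i,j)" .
  qed (use W in auto)
  then show ?thesis using W colW[OF n0] hd unfolding g_def by metis
qed

text \<open>Deflation: in an orthonormal basis whose first vector is an eigenvector, a symmetric
  matrix splits into the eigenvalue and a symmetric block of size one less, to which the induction
  hypothesis applies.\<close>

lemma real_spectral_theorem:
  fixes M :: "real mat"
  assumes "M \<in> carrier_mat n n" "transpose_mat M = M"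
  shows "\<exists>U l. U \<in> carrier_mat n n \<and> transpose_mat U * U = 1\<^sub>m n
            \<and> M = U * mat_diag n l * transpose_mat U"
  using assms
proof (induction n arbitrary: M)
  case 0
  then show ?case by (intro exI[of _ "1\<^sub>m 0"] exI[of _ "\<lambda>_. 0"] conjI eq_matI) auto
next
  case (Suc n)
  let ?N = "Suc n"
  note M = Suc.prems(1)
  obtain e where "eigenvalue M e" using symmetric_eigenvalue_exists[OF Suc.prems] by auto
  then obtain v where v: "v \<in> carrier_vec ?N" "v \<noteq> 0\<^sub>v ?N" "M *\<^sub>v v = e \<cdot>\<^sub>v v"
    using M by (auto simp: eigenvalue_def eigenvector_def)
  obtain W c where W: "W \<in> carrier_mat ?N ?N" and WtW: "transpose_mat W * W = 1\<^sub>m ?N"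
    and colW: "col W 0 = c \<cdot>\<^sub>v v" using orthogonal_completion[OF v(1,2)] by auto
  have Wt: "transpose_mat W \<in> carrier_mat ?N ?N" using W by simp
  have WWt: "W * transpose_mat W = 1\<^sub>m ?N" by (rule mat_mult_left_right_inverse[OF Wt W WtW])
  define B where "B = transpose_mat W * M * W"
  have B: "B \<in> carrier_mat ?N ?N" using W M by (simp add: B_def)
  have symB: "transpose_mat B = B"
  proof -
    have "transpose_mat B = transpose_mat W * transpose_mat (transpose_mat W * M)"
      unfolding B_def using W M by (intro transpose_mult[of _ ?N ?N]) auto
    also have "transpose_mat (transpose_mat W * M) = M * W"
      using transpose_mult[OF Wt M] Suc.prems(2) by simp
    finally show ?thesis unfolding B_def using assoc_mult_mat[OF Wt M W] by simp
  qed
  have sB: "B $$ (i,j) = B $$ (j,i)" if "i < ?N" "j < ?N" for i j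
    using that B symB by (metis carrier_matD index_transpose_mat(1))
  have colB: "col B 0 = e \<cdot>\<^sub>v unit_vec ?N 0"
  proof -
    have 1: "col (1\<^sub>m ?N) 0 = unit_vec ?N 0" by simp
    have cW: "col W 0 \<in> carrier_vec ?N" using colW v(1) by simp
    have "col B 0 = transpose_mat W * M *\<^sub>v col W 0"
      unfolding B_def using W M by (intro col_mult2[of _ ?N ?N]) auto
    also have "\<dots> = transpose_mat W *\<^sub>v (M *\<^sub>v col W 0)"
      using W M cW by (intro assoc_mult_mat_vec[of _ ?N ?N]) auto
    also have "M *\<^sub>v col W 0 = e \<cdot>\<^sub>v col W 0"
      unfolding colW using mult_mat_vec[OF M v(1)] v by (simp add: smult_smult_assoc mult.commute)
    also have "transpose_mat W *\<^sub>v (e \<cdot>\<^sub>v col W 0) = e \<cdot>\<^sub>v (transpose_mat W *\<^sub>v col W 0)"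
      using W cW by (intro mult_mat_vec[of _ ?N ?N]) auto
    also have "transpose_mat W *\<^sub>v col W 0 = col (transpose_mat W * W) 0"
      using col_mult2[OF Wt W, of 0] by simp
    finally show ?thesis using WtW 1 by simp
  qed
  have B0: "B $$ (i,0) = (if i = 0 then e else 0)" if "i < ?N" for i
  proof -
    have "B $$ (i,0) = col B 0 $ i" using that B by simp
    then show ?thesis using that unfolding colB by simp
  qed
  define B3 where "B3 = mat n n (\<lambda>(i,j). B $$ (Suc i, Suc j))"
  have B3: "B3 \<in> carrier_mat n n" by (simp add: B3_def)
  have symB3: "transpose_mat B3 = B3"
    by (intro eq_matI) (auto simp: B3_def sB)
  obtain V l where V: "V \<in> carrier_mat n n" "transpose_mat V * V = 1\<^sub>m n"
    and BV: "B3 = V * mat_diag n l * transpose_mat V" using Suc.IH[OF B3 symB3] by auto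
  let ?F = "\<lambda>X Y. four_block_mat X (0\<^sub>m 1 n) (0\<^sub>m n 1) Y"
  define E where "E = mat 1 1 (\<lambda>_. e)"
  have E: "E \<in> carrier_mat 1 1" by (simp add: E_def)
  have D: "mat_diag n l \<in> carrier_mat n n" by simp
  \<comment> \<open>Column 0 of \<open>B\<close> is \<open>e\<close> times a unit vector, and
    symmetry transfers this to row 0, so both off-diagonal blocks vanish.\<close>
  have BF: "B = ?F E B3"
    using B by (intro eq_matI) (auto simp: E_def B3_def B0 sB[of 0])
  have mF: "?F X Y * ?F X' Y' = ?F (X * X') (Y * Y')"
    if "X \<in> carrier_mat 1 1" "X' \<in> carrier_mat 1 1" "Y \<in> carrier_mat n n" "Y' \<in> carrier_mat n n"
    for X X' Y Y' :: "real mat"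
    using that by (subst mult_four_block_mat[of _ 1 1 _ n _ n _ _ 1 _ n]) auto
  have tF: "transpose_mat (?F X Y) = ?F (transpose_mat X) (transpose_mat Y)"
    if "X \<in> carrier_mat 1 1" "Y \<in> carrier_mat n n" for X Y :: "real mat"
    using that by (subst transpose_four_block_mat[of _ 1 1 _ n _ n]) auto
  \<comment> \<open>The diagonalizing matrix of the smaller block is extended by a 1 in the corner,
    so that it leaves the eigenvector already found untouched; \<open>l'\<close> puts
    \<open>e\<close> in front of the remaining eigenvalues.\<close>
  define Q where "Q = ?F (1\<^sub>m 1) V"
  define l' where "l' i = (case i of 0 \<Rightarrow> e | Suc i \<Rightarrow> l i)" for i
  have Q: "Q \<in> carrier_mat ?N ?N" using V four_block_carrier_mat[of "1\<^sub>m 1" 1 1 V n n] by (simp add: Q_def)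
  have Qt: "transpose_mat Q \<in> carrier_mat ?N ?N" using Q by simp
  have D': "mat_diag ?N l' = ?F E (mat_diag n l)"
    by (intro eq_matI) (auto simp: mat_diag_def E_def l'_def split: nat.splits)
  have QtF: "transpose_mat Q = ?F (1\<^sub>m 1) (transpose_mat V)"
    unfolding Q_def using V by (subst tF) auto
  have QtQ: "transpose_mat Q * Q = 1\<^sub>m ?N"
    unfolding QtF unfolding Q_def using V by (subst mF) auto
  have "Q * mat_diag ?N l' * transpose_mat Q = ?F (1\<^sub>m 1 * E * 1\<^sub>m 1) (V * mat_diag n l * transpose_mat V)"
    unfolding D' QtF unfolding Q_def using V E D
    by (metis mF mult_carrier_mat one_carrier_mat transpose_carrier_mat)
  also have "\<dots> = B" unfolding BF BV using E by simp
  finally have QB: "Q * mat_diag ?N l' * transpose_mat Q = B" .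
  have D'c: "mat_diag ?N l' \<in> carrier_mat ?N ?N" by simp
  define U where "U = W * Q"
  have U: "U \<in> carrier_mat ?N ?N" using W Q by (simp add: U_def)
  have Ut: "transpose_mat U = transpose_mat Q * transpose_mat W"
    unfolding U_def by (rule transpose_mult[OF W Q])
  note assoc = assoc_mult_mat[of _ ?N ?N _ ?N _ ?N] mult_carrier_mat[of _ ?N ?N _ ?N]
  have WtWX: "transpose_mat W * (W * X) = X" if "X \<in> carrier_mat ?N ?N" for X
    using assoc(1)[OF Wt W that] WtW that by simp
  have WWtX: "W * (transpose_mat W * X) = X" if "X \<in> carrier_mat ?N ?N" for X
    using assoc(1)[OF W Wt that] WWt that by simp
  have 1: "transpose_mat U * U = 1\<^sub>m ?N"
    unfolding Ut unfolding U_def using W Q Wt Qt by (simp add: assoc WtWX QtQ)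
  have "U * mat_diag ?N l' * transpose_mat U = W * (Q * mat_diag ?N l' * transpose_mat Q) * transpose_mat W"
    unfolding Ut unfolding U_def using W Q Wt Qt D'c by (simp add: assoc)
  also have "\<dots> = M"
    unfolding QB unfolding B_def using W Wt M by (simp add: assoc WWtX WWt)
  finally show ?case using U 1 by metis
qed

section \<open>Pseudoinverse and quadratic forms\<close>

lemma scalar_prod_self_nonneg: "0 \<le> v \<bullet> (v :: real vec)"
  by (simp add: scalar_prod_def sum_nonneg)

lemma scalar_prod_self_eq_0_iff:
  "v \<in> carrier_vec n \<Longrightarrow> v \<bullet> v = 0 \<longleftrightarrow> v = 0\<^sub>v n" for v :: "real vec"
  by (auto simp: scalar_prod_def sum_nonneg_eq_0_iff intro!: eq_vecI)

lemma l2norm_squared: "(l2norm v)\<^sup>2 = v \<bullet> v"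
  by (simp add: l2norm_def scalar_prod_self_nonneg)

lemma scalar_prod_Cauchy:
  fixes u v :: "real vec"
  assumes "u \<in> carrier_vec n" "v \<in> carrier_vec n"
  shows "(u \<bullet> v)\<^sup>2 \<le> (u \<bullet> u) * (v \<bullet> v)"
  using Cauchy_Schwarz_ineq_sum[of "($) u" "($) v" "{0..<n}"] assms
  by (simp add: scalar_prod_def power2_eq_square)

text \<open>\<open>c y\<close> lists the coordinates of \<open>y\<close> in an orthonormal
  eigenbasis and \<open>l\<close> the matching eigenvalues. In this form, estimates of quadratic
  forms become termwise estimates of finite sums.\<close>

lemma spectral_coordinates:
  fixes M :: "real mat"
  assumes M: "M \<in> carrier_mat n n" and "transpose_mat M = M"
  obtains c :: "real vec \<Rightarrow> nat \<Rightarrow> real" and l where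
    "\<And>y z. y \<in> carrier_vec n \<Longrightarrow> z \<in> carrier_vec n \<Longrightarrow> y \<bullet> z = (\<Sum>i<n. c y i * c z i)"
    "\<And>y i. y \<in> carrier_vec n \<Longrightarrow> i < n \<Longrightarrow> c (M *\<^sub>v y) i = l i * c y i"
    "\<And>i. i < n \<Longrightarrow> l i \<in> spectrum M"
proof -
  obtain U l where U: "U \<in> carrier_mat n n" and UtU: "transpose_mat U * U = 1\<^sub>m n"
    and MU: "M = U * mat_diag n l * transpose_mat U" using real_spectral_theorem[OF assms] by auto
  have Ut: "transpose_mat U \<in> carrier_mat n n" and D: "mat_diag n l \<in> carrier_mat n n" using U by auto
  have UUt: "U * transpose_mat U = 1\<^sub>m n" by (rule mat_mult_left_right_inverse[OF Ut U UtU])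
  define c where "c y i = (transpose_mat U *\<^sub>v y) $ i" for y i
  have 1: "y \<bullet> z = (\<Sum>i<n. c y i * c z i)" if y: "y \<in> carrier_vec n" and z: "z \<in> carrier_vec n" for y z
  proof -
    have "y \<bullet> z = y \<bullet> (U *\<^sub>v (transpose_mat U *\<^sub>v z))"
      using UUt z assoc_mult_mat_vec[OF U Ut z] by simp
    also have "\<dots> = (transpose_mat U *\<^sub>v y) \<bullet> (transpose_mat U *\<^sub>v z)"
      using scalar_prod_transpose[OF Ut y, of "transpose_mat U *\<^sub>v z"] Ut z by simp
    also have "\<dots> = (\<Sum>i<n. c y i * c z i)"
      using U by (simp add: scalar_prod_def c_def atLeast0LessThan)
    finally show ?thesis .
  qed
  have DU: "transpose_mat U * M = mat_diag n l * transpose_mat U"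
  proof -
    have "transpose_mat U * M = transpose_mat U * (U * (mat_diag n l * transpose_mat U))"
      unfolding MU using assoc_mult_mat[OF U D Ut] by simp
    also have "\<dots> = mat_diag n l * transpose_mat U"
      using assoc_mult_mat[OF Ut U, of "mat_diag n l * transpose_mat U" n] UtU
        left_mult_one_mat[of "mat_diag n l * transpose_mat U" n n] mult_carrier_mat[OF D Ut] by simp
    finally show ?thesis .
  qed
  have 2: "c (M *\<^sub>v y) i = l i * c y i" if y: "y \<in> carrier_vec n" and i: "i < n" for y i
  proof -
    have "transpose_mat U *\<^sub>v (M *\<^sub>v y) = mat_diag n l *\<^sub>v (transpose_mat U *\<^sub>v y)"
      using assoc_mult_mat_vec[OF Ut M y] assoc_mult_mat_vec[OF D Ut y] DU by simp
    then have "c (M *\<^sub>v y) i = (mat_diag n l *\<^sub>v (transpose_mat U *\<^sub>v y)) $ i" by (simp add: c_def)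
    also have "\<dots> = (\<Sum>j<n. (if i = j then l j else 0) * c y j)"
      using i U by (simp add: scalar_prod_def c_def mat_diag_def atLeast0LessThan)
    also have "\<dots> = (\<Sum>j<n. if i = j then l j * c y j else 0)" by (intro sum.cong) auto
    also have "\<dots> = l i * c y i" using i by simp
    finally show ?thesis .
  qed
  have 3: "l i \<in> spectrum M" if i: "i < n" for i
  proof -
    let ?u = "col U i"
    have u: "?u \<in> carrier_vec n" using U i by auto
    have cu: "c ?u j = (if i = j then 1 else 0)" if "j < n" for j
      using that i U UtU col_mult2[OF Ut U i] index_mult_mat(1)[of j "transpose_mat U" i U]
      unfolding c_def by auto
    have "(\<Sum>k<n. c ?u k * c ?u k) = (\<Sum>k<n. if i = k then 1 else 0)"
      by (intro sum.cong) (auto simp: cu)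
    then have "?u \<bullet> ?u = 1" using 1[OF u u] i by simp
    then have u0: "?u \<noteq> 0\<^sub>v n" by auto
    have Mu: "M *\<^sub>v ?u \<in> carrier_vec n" using M u by simp
    have lu: "l i \<cdot>\<^sub>v ?u \<in> carrier_vec n" using u by simp
    have cl: "c (l i \<cdot>\<^sub>v ?u) j = l i * c ?u j" if "j < n" for j
      using mult_mat_vec[OF Ut u, of "l i"] that U by (simp add: c_def)
    \<comment> \<open>The defect in the eigenvector equation for column \<open>i\<close> of
      \<open>U\<close> has only zero coordinates, so its norm is zero.\<close>
    define r where "r = M *\<^sub>v ?u - l i \<cdot>\<^sub>v ?u"
    have r: "r \<in> carrier_vec n" using Mu lu by (simp add: r_def)
    have cr: "c r j = 0" if "j < n" for j
      using mult_minus_distrib_mat_vec[OF Ut Mu lu] that U 2[OF u that] cl[OF that] cu[OF that]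
      unfolding r_def c_def by (auto split: if_splits)
    have "r \<bullet> r = 0" using 1[OF r r] cr by simp
    then have "r = 0\<^sub>v n" using scalar_prod_self_eq_0_iff[OF r] by simp
    then have "M *\<^sub>v ?u = l i \<cdot>\<^sub>v ?u" using Mu lu u M unfolding r_def
      by (intro eq_vecI) (auto simp: vec_eq_iff)
    then show ?thesis using u u0 M by (auto simp: spectrum_def eigenvalue_def eigenvector_def)
  qed
  show ?thesis using that 1 2 3 by blast
qed

lemma quadratic_form_le_lambda_max:
  fixes M :: "real mat"
  assumes M: "M \<in> carrier_mat n n" and "transpose_mat M = M" and y: "y \<in> carrier_vec n"
  shows "y \<bullet> (M *\<^sub>v y) \<le> lambda_max M * (y \<bullet> y)"
proof -
  obtain c l where cl: "\<And>y z. y \<in> carrier_vec n \<Longrightarrow> z \<in> carrier_vec n \<Longrightarrow> y \<bullet> z = (\<Sum>i<n. c y i * c z i)"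
    "\<And>y i. y \<in> carrier_vec n \<Longrightarrow> i < n \<Longrightarrow> c (M *\<^sub>v y) i = l i * c y i"
    "\<And>i. i < n \<Longrightarrow> l i \<in> spectrum M" using spectral_coordinates[OF assms(1,2)] by blast
  have l: "l i \<le> lambda_max M" if "i < n" for i
    using cl(3)[OF that] card_finite_spectrum(1)[OF M] by (simp add: lambda_max_def)
  have "y \<bullet> (M *\<^sub>v y) = (\<Sum>i<n. l i * (c y i * c y i))"
    using cl(1)[OF y, of "M *\<^sub>v y"] M y cl(2)[OF y] by (simp add: algebra_simps)
  also have "\<dots> \<le> (\<Sum>i<n. lambda_max M * (c y i * c y i))"
    using l by (intro sum_mono mult_right_mono) auto
  also have "\<dots> = lambda_max M * (y \<bullet> y)" using cl(1)[OF y y] by (simp add: sum_distrib_left)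
  finally show ?thesis .
qed

lemma quadratic_form_ge_lambda_min:
  fixes M :: "real mat"
  assumes M: "M \<in> carrier_mat n n" and "transpose_mat M = M" and y: "y \<in> carrier_vec n"
  shows "lambda_min M * (y \<bullet> y) \<le> y \<bullet> (M *\<^sub>v y)"
proof -
  obtain c l where cl: "\<And>y z. y \<in> carrier_vec n \<Longrightarrow> z \<in> carrier_vec n \<Longrightarrow> y \<bullet> z = (\<Sum>i<n. c y i * c z i)"
    "\<And>y i. y \<in> carrier_vec n \<Longrightarrow> i < n \<Longrightarrow> c (M *\<^sub>v y) i = l i * c y i"
    "\<And>i. i < n \<Longrightarrow> l i \<in> spectrum M" using spectral_coordinates[OF assms(1,2)] by blast
  have l: "lambda_min M \<le> l i" if "i < n" for i
    using cl(3)[OF that] card_finite_spectrum(1)[OF M] by (simp add: lambda_min_def)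
  have "lambda_min M * (y \<bullet> y) = (\<Sum>i<n. lambda_min M * (c y i * c y i))"
    using cl(1)[OF y y] by (simp add: sum_distrib_left)
  also have "\<dots> \<le> (\<Sum>i<n. l i * (c y i * c y i))"
    using l by (intro sum_mono mult_right_mono) auto
  also have "\<dots> = y \<bullet> (M *\<^sub>v y)"
    using cl(1)[OF y, of "M *\<^sub>v y"] M y cl(2)[OF y] by (simp add: algebra_simps)
  finally show ?thesis .
qed

section \<open>Gram matrices and existence of the pseudoinverse\<close>

lemma gram_carrier: "A \<in> carrier_mat n d \<Longrightarrow> transpose_mat A * A \<in> carrier_mat d d" for A :: "real mat"
  by auto

lemma gram_symmetric: "transpose_mat (transpose_mat A * A) = transpose_mat A * (A :: real mat)"
  by (subst transpose_mult[of _ "dim_col A" "dim_row A" _ "dim_col A"]) auto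

lemma gram_scalar_prod:
  fixes A :: "real mat"
  assumes A: "A \<in> carrier_mat n d" and x: "x \<in> carrier_vec d" and y: "y \<in> carrier_vec d"
  shows "x \<bullet> ((transpose_mat A * A) *\<^sub>v y) = (A *\<^sub>v x) \<bullet> (A *\<^sub>v y)"
  using scalar_prod_transpose[OF A x, of "A *\<^sub>v y"] A y
    assoc_mult_mat_vec[of "transpose_mat A" d n A d y] by simp

text \<open>The diagonal entries of the Gram matrix are the squared norms of the columns of
  \<open>A\<close>.\<close>

lemma gram_eq_0D:
  fixes A :: "real mat"
  assumes A: "A \<in> carrier_mat n d" and 0: "transpose_mat A * A = 0\<^sub>m d d"
  shows "A = 0\<^sub>m n d"
proof (rule eq_matI)
  fix i j assume "i < dim_row (0\<^sub>m n d :: real mat)" "j < dim_col (0\<^sub>m n d :: real mat)"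
  then have ij: "i < n" "j < d" by auto
  have "col A j \<bullet> col A j = (transpose_mat A * A) $$ (j,j)" using A ij by simp
  then have "col A j = 0\<^sub>v n" using 0 ij A scalar_prod_self_eq_0_iff[of "col A j" n] by auto
  then show "A $$ (i,j) = 0\<^sub>m n d $$ (i,j)" using ij A by (metis carrier_matD index_col index_zero_mat(1) index_zero_vec(1))
qed (use A in auto)

text \<open>Diagonalize the Gram matrix \<open>M\<close>, invert its nonzero eigenvalues to get its
  pseudoinverse \<open>G\<close>, and take \<open>G * transpose_mat A\<close>. The Penrose
  identities for this product follow from those relating \<open>G\<close> and
  \<open>M\<close>.\<close>

lemma pinv_exists:
  fixes A :: "real mat"
  shows "\<exists>X. is_pinv A X"
proof -
  define n d where "n = dim_row A" and "d = dim_col A"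
  have A: "A \<in> carrier_mat n d" by (simp add: n_def d_def)
  have At: "transpose_mat A \<in> carrier_mat d n" using A by simp
  define M where "M = transpose_mat A * A"
  have M: "M \<in> carrier_mat d d" using A by (simp add: M_def)
  have symM: "transpose_mat M = M" unfolding M_def by (rule gram_symmetric)
  obtain U l where U: "U \<in> carrier_mat d d" and UtU: "transpose_mat U * U = 1\<^sub>m d"
    and MU: "M = U * mat_diag d l * transpose_mat U" using real_spectral_theorem[OF M symM] by auto
  have Ut: "transpose_mat U \<in> carrier_mat d d" using U by auto
  note assoc = assoc_mult_mat[of _ d d _ d _ d] mult_carrier_mat[of _ d d _ d]
  have UtUX: "transpose_mat U * (U * X) = X" if "X \<in> carrier_mat d d" for X
    using assoc(1)[OF Ut U that] UtU that by simp
  have DX: "mat_diag d f * (mat_diag d g * X) = mat_diag d (\<lambda>i. f i * g i) * X"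
    if "X \<in> carrier_mat d d" for X and f g :: "nat \<Rightarrow> real"
    using assoc(1)[of "mat_diag d f" "mat_diag d g" X] that by simp
  \<comment> \<open>The convention \<open>inverse 0 = 0\<close> keeps the zero eigenvalues at zero,
    as the pseudoinverse requires.\<close>
  define G where "G = U * mat_diag d (\<lambda>i. inverse (l i)) * transpose_mat U"
  have G: "G \<in> carrier_mat d d" using U Ut by (simp add: G_def assoc)
  have li: "l i * (l i * inverse (l i)) = l i" "l i * (inverse (l i) * inverse (l i)) = inverse (l i)" for i
    by (cases "l i = 0"; simp)+
  have MG: "M * G = G * M" and MGM: "M * G * M = M" and GMG: "G * M * G = G"
    unfolding MU G_def using U Ut by (simp_all add: assoc UtUX DX mult.commute mult.left_commute)
       (simp_all add: li)
  have symG: "transpose_mat G = G"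
  proof -
    have tD: "transpose_mat (mat_diag d f) = mat_diag d f" for f :: "nat \<Rightarrow> real"
      by (intro eq_matI) (auto simp: mat_diag_def)
    show ?thesis unfolding G_def using U Ut
      by (simp add: transpose_mult[of _ d d _ d] assoc tD)
  qed
  define X where "X = G * transpose_mat A"
  have X: "X \<in> carrier_mat d n" using G At by (simp add: X_def)
  have XA: "X * A = G * M" unfolding X_def M_def using G At A by (rule assoc_mult_mat)
  have symXA: "transpose_mat (X * A) = X * A"
    unfolding XA using transpose_mult[OF G M] symM symG MG by simp
  have AX: "A * X = A * G * transpose_mat A" unfolding X_def using A G At by simp
  have symAX: "transpose_mat (A * X) = A * X"
    unfolding AX using transpose_mult[OF mult_carrier_mat[OF A G] At] transpose_mult[OF A G] symG
      assoc_mult_mat[OF A G At] by simp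
  have XAX: "X * A * X = X"
    unfolding XA unfolding X_def using assoc_mult_mat[of "G * M" d d G d "transpose_mat A" n] G M At GMG by simp
  have AXA: "A * X * A = A"
  proof -
    \<comment> \<open>The identity \<open>M * G * M = M\<close> says \<open>M * H = 0\<close>. Hence
      the Gram matrix of \<open>A * H\<close> vanishes, so \<open>A * H\<close> itself does, which
      gives \<open>A * (G * M) = A\<close>.\<close>
    define H where "H = G * M - 1\<^sub>m d"
    have GM: "G * M \<in> carrier_mat d d" using G M by simp
    have H: "H \<in> carrier_mat d d" unfolding H_def by (rule minus_carrier_mat[OF one_carrier_mat])
    have MH: "M * H = 0\<^sub>m d d"
      unfolding H_def using mult_minus_distrib_mat[OF M GM, of "1\<^sub>m d"] MGM M G
        assoc_mult_mat[OF M G M] by simp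
    have "transpose_mat (A * H) * (A * H) = transpose_mat H * (M * H)"
      unfolding M_def using A H At transpose_mult[OF A H]
      by (simp add: assoc_mult_mat[of _ d d _ n _ d] assoc_mult_mat[of _ d n _ d _ d])
    also have "\<dots> = 0\<^sub>m d d" unfolding MH using H by simp
    finally have AH: "A * H = 0\<^sub>m n d"
      using gram_eq_0D[of "A * H" n d] A H by simp
    have AGM: "A * (G * M) \<in> carrier_mat n d" using A GM by simp
    have AH': "A * H = A * (G * M) - A"
      unfolding H_def using mult_minus_distrib_mat[OF A GM, of "1\<^sub>m d"] A by simp
    have "A * X * A = A * (G * M)" using assoc_mult_mat[OF A X A] XA by simp
    also have "\<dots> = A"
    proof (rule eq_matI)
      fix i j assume "i < dim_row A" "j < dim_col A"
      then have ij: "i < n" "j < d" using A by auto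
      have "(A * (G * M) - A) $$ (i,j) = 0" using AH AH' ij by simp
      then show "(A * (G * M)) $$ (i,j) = A $$ (i,j)" using AGM A ij by simp
    qed (use AGM A in auto)
    finally show ?thesis .
  qed
  have "is_pinv A X" unfolding is_pinv_def using X AXA XAX symAX symXA n_def d_def by simp
  then show ?thesis ..
qed

lemma is_pinv_pinv: "is_pinv A (pinv A)"
  unfolding pinv_def using pinv_exists is_pinv_unique by (metis theI)

lemma pinv_carrier: "A \<in> carrier_mat n d \<Longrightarrow> pinv A \<in> carrier_mat d n"
  using is_pinv_pinv[of A] by (auto simp: is_pinv_def)

section \<open>Singular values\<close>

text \<open>For an eigenvector \<open>v\<close>, the number \<open>l * (v \<bullet> v)\<close> is
  the squared norm of \<open>A *\<^sub>v v\<close>.\<close>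

lemma eigenvalue_gram_nonneg:
  fixes A :: "real mat"
  assumes l: "l \<in> spectrum (transpose_mat A * A)"
  shows "0 \<le> l"
proof -
  define n d where "n = dim_row A" and "d = dim_col A"
  have A: "A \<in> carrier_mat n d" by (simp add: n_def d_def)
  obtain v where v: "v \<in> carrier_vec d" "v \<noteq> 0\<^sub>v d" "(transpose_mat A * A) *\<^sub>v v = l \<cdot>\<^sub>v v"
    using l A by (auto simp: spectrum_def eigenvalue_def eigenvector_def)
  have "l * (v \<bullet> v) = (A *\<^sub>v v) \<bullet> (A *\<^sub>v v)"
    using gram_scalar_prod[OF A v(1) v(1)] v(1,3) by simp
  moreover have "0 < v \<bullet> v"
    using scalar_prod_self_eq_0_iff[OF v(1)] v(2) scalar_prod_self_nonneg[of v] by simp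
  ultimately show ?thesis using scalar_prod_self_nonneg[of "A *\<^sub>v v"]
    by (metis not_le mult_neg_pos)
qed

lemma finite_singular_values: "finite (singular_values A)"
  unfolding singular_values_def using card_finite_spectrum(1)[OF gram_carrier[of A "dim_row A" "dim_col A"]] by simp

text \<open>The extra factor \<open>l\<close> makes the estimate cover the zero eigenvalue as well.
  For positive \<open>l\<close>, its square root is one of the nonzero singular values over which
  the minimum is taken.\<close>

lemma sigma_min_le_eigenvalue:
  fixes A :: "real mat"
  assumes l: "l \<in> spectrum (transpose_mat A * A)"
  shows "(sigma_min A)\<^sup>2 * l \<le> l\<^sup>2"
proof (cases "l = 0")
  case False
  then have l0: "l > 0" using eigenvalue_gram_nonneg[OF l] by simp
  let ?S = "singular_values A - {0}"
  have S: "finite ?S" "sqrt l \<in> ?S" using finite_singular_values l l0 by (auto simp: singular_values_def)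
  have "Min ?S \<in> ?S" using S by (intro Min_in) auto
  then have "0 \<le> sigma_min A" using eigenvalue_gram_nonneg unfolding sigma_min_def singular_values_def by auto
  moreover have "sigma_min A \<le> sqrt l" using S unfolding sigma_min_def by simp
  ultimately have "(sigma_min A)\<^sup>2 \<le> (sqrt l)\<^sup>2" by (intro power_mono) auto
  then show ?thesis using l0 by (simp add: power2_eq_square)
qed simp

text \<open>If zero were the only eigenvalue of the Gram matrix, the Gram matrix and with it
  \<open>A\<close> would vanish. So the minimum is taken over a nonempty finite set of positive
  numbers.\<close>

lemma sigma_min_pos:
  assumes A: "A \<in> carrier_mat n d" and A0: "A \<noteq> 0\<^sub>m n d"
  shows "0 < sigma_min A"
proof -
  let ?S = "singular_values A - {0}" and ?M = "transpose_mat A * A"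
  have M: "?M \<in> carrier_mat d d" using A by (rule gram_carrier)
  have "?S \<noteq> {}"
  proof
    assume "?S = {}"
    then have sp: "l = 0" if "l \<in> spectrum ?M" for l using that unfolding singular_values_def by auto
    obtain c l where cl: "\<And>y z. y \<in> carrier_vec d \<Longrightarrow> z \<in> carrier_vec d \<Longrightarrow> y \<bullet> z = (\<Sum>i<d. c y i * c z i)"
      "\<And>y i. y \<in> carrier_vec d \<Longrightarrow> i < d \<Longrightarrow> c (?M *\<^sub>v y) i = l i * c y i"
      "\<And>i. i < d \<Longrightarrow> l i \<in> spectrum ?M" using spectral_coordinates[OF M gram_symmetric] by blast
    have z: "y \<bullet> (?M *\<^sub>v z) = 0" if "y \<in> carrier_vec d" "z \<in> carrier_vec d" for y z
    proof -
      have Mz: "?M *\<^sub>v z \<in> carrier_vec d" using M that by simp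
      show ?thesis using cl(1)[OF that(1) Mz] cl(2)[OF that(2)] sp[OF cl(3)] by simp
    qed
    have "?M = 0\<^sub>m d d"
    proof (rule eq_matI)
      fix i j assume "i < dim_row (0\<^sub>m d d :: real mat)" "j < dim_col (0\<^sub>m d d :: real mat)"
      then have ij: "i < d" "j < d" by auto
      have "?M *\<^sub>v unit_vec d j = col ?M j" using ij M by (intro eq_vecI) auto
      then have "unit_vec d i \<bullet> (?M *\<^sub>v unit_vec d j) = ?M $$ (i,j)"
        using ij M carrier_matD[OF M] by (simp del: index_mult_mat)
      then show "?M $$ (i,j) = 0\<^sub>m d d $$ (i,j)" using z[of "unit_vec d i" "unit_vec d j"] ij by simp
    qed (use M in auto)
    then show False using gram_eq_0D[OF A] A0 by simp
  qed
  then have "Min ?S \<in> ?S" using finite_singular_values by (intro Min_in) auto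
  then show ?thesis using eigenvalue_gram_nonneg unfolding sigma_min_def singular_values_def
    by (auto simp: less_le)
qed

section \<open>Penrose identities and lower bounds on the range and the row space\<close>

lemma pinv_identities:
  fixes A :: "real mat"
  assumes A: "A \<in> carrier_mat n d"
  shows "A * pinv A * A = A" "pinv A * A * pinv A = pinv A"
    "transpose_mat (A * pinv A) = A * pinv A" "transpose_mat (pinv A * A) = pinv A * A"
    "transpose_mat A * (A * pinv A) = transpose_mat A"
    "pinv A * A * transpose_mat A = transpose_mat A"
proof -
  note X = pinv_carrier[OF A]
  show 1: "A * pinv A * A = A" "pinv A * A * pinv A = pinv A"
    "transpose_mat (A * pinv A) = A * pinv A" "transpose_mat (pinv A * A) = pinv A * A"
    using is_pinv_pinv[of A] by (simp_all add: is_pinv_def)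
  \<comment> \<open>The last two identities are the transposes of \<open>A * pinv A * A = A\<close>,
    with the symmetric projections kept intact.\<close>
  show "transpose_mat A * (A * pinv A) = transpose_mat A"
    using transpose_mult[OF mult_carrier_mat[OF A X] A] 1 by simp
  show "pinv A * A * transpose_mat A = transpose_mat A"
    using transpose_mult[OF A mult_carrier_mat[OF X A]] 1 assoc_mult_mat[OF A X A] by simp
qed

text \<open>In eigencoordinates of \<open>u\<close>, the squared norm of \<open>w\<close> has
  weights \<open>l i\<close> and that of \<open>transpose_mat A *\<^sub>v w\<close> has weights
  \<open>(l i)\<^sup>2\<close>, so \<open>sigma_min_le_eigenvalue\<close> applies term by
  term.\<close>

lemma sigma_min_le_range:
  fixes A :: "real mat"
  assumes A: "A \<in> carrier_mat n d" and u: "u \<in> carrier_vec d" and w: "w = A *\<^sub>v u"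
  shows "(sigma_min A)\<^sup>2 * (w \<bullet> w) \<le> (transpose_mat A *\<^sub>v w) \<bullet> (transpose_mat A *\<^sub>v w)"
proof -
  let ?M = "transpose_mat A * A"
  have M: "?M \<in> carrier_mat d d" using A by (rule gram_carrier)
  obtain c l where cl: "\<And>y z. y \<in> carrier_vec d \<Longrightarrow> z \<in> carrier_vec d \<Longrightarrow> y \<bullet> z = (\<Sum>i<d. c y i * c z i)"
    "\<And>y i. y \<in> carrier_vec d \<Longrightarrow> i < d \<Longrightarrow> c (?M *\<^sub>v y) i = l i * c y i"
    "\<And>i. i < d \<Longrightarrow> l i \<in> spectrum ?M" using spectral_coordinates[OF M gram_symmetric] by blast
  have Mu: "?M *\<^sub>v u \<in> carrier_vec d" using M u by simp
  have "w \<bullet> w = u \<bullet> (?M *\<^sub>v u)" unfolding w using gram_scalar_prod[OF A u u] by simp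
  also have "\<dots> = (\<Sum>i<d. l i * (c u i)\<^sup>2)"
    using cl(1)[OF u Mu] cl(2)[OF u] by (simp add: power2_eq_square mult_ac)
  finally have "(sigma_min A)\<^sup>2 * (w \<bullet> w) = (\<Sum>i<d. ((sigma_min A)\<^sup>2 * l i) * (c u i)\<^sup>2)"
    by (simp add: sum_distrib_left mult_ac)
  also have "\<dots> \<le> (\<Sum>i<d. (l i)\<^sup>2 * (c u i)\<^sup>2)"
    using sigma_min_le_eigenvalue[OF cl(3)] by (intro sum_mono mult_right_mono) auto
  also have "\<dots> = (?M *\<^sub>v u) \<bullet> (?M *\<^sub>v u)"
    using cl(1)[OF Mu Mu] cl(2)[OF u] by (simp add: power2_eq_square mult_ac)
  also have "?M *\<^sub>v u = transpose_mat A *\<^sub>v w"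
    unfolding w using A u by (intro assoc_mult_mat_vec[of _ d n]) auto
  finally show ?thesis .
qed

text \<open>A vector of the row space is the image under the Gram matrix of some \<open>t\<close>,
  so its coordinates carry a factor \<open>l i\<close>. The termwise comparison is then that of
  \<open>sigma_min_le_eigenvalue\<close> multiplied by the nonnegative \<open>l i\<close>.\<close>

lemma sigma_min_le_row_space:
  fixes A :: "real mat"
  assumes A: "A \<in> carrier_mat n d" and v: "v \<in> carrier_vec n" and e: "e = transpose_mat A *\<^sub>v v"
  shows "(sigma_min A)\<^sup>2 * (e \<bullet> e) \<le> (A *\<^sub>v e) \<bullet> (A *\<^sub>v e)"
proof -
  let ?M = "transpose_mat A * A"
  have At: "transpose_mat A \<in> carrier_mat d n" using A by simp
  have M: "?M \<in> carrier_mat d d" using A by (rule gram_carrier)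
  obtain c l where cl: "\<And>y z. y \<in> carrier_vec d \<Longrightarrow> z \<in> carrier_vec d \<Longrightarrow> y \<bullet> z = (\<Sum>i<d. c y i * c z i)"
    "\<And>y i. y \<in> carrier_vec d \<Longrightarrow> i < d \<Longrightarrow> c (?M *\<^sub>v y) i = l i * c y i"
    "\<And>i. i < d \<Longrightarrow> l i \<in> spectrum ?M" using spectral_coordinates[OF M gram_symmetric] by blast
  define t where "t = pinv A *\<^sub>v v"
  have t: "t \<in> carrier_vec d" using pinv_carrier[OF A] v by (simp add: t_def)
  have ec: "e \<in> carrier_vec d" using At v e by simp
  have eMt: "e = ?M *\<^sub>v t"
  proof -
    have "?M *\<^sub>v t = transpose_mat A *\<^sub>v (A *\<^sub>v t)" using assoc_mult_mat_vec[OF At A t] by simp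
    also have "A *\<^sub>v t = (A * pinv A) *\<^sub>v v" unfolding t_def
      using assoc_mult_mat_vec[OF A pinv_carrier[OF A] v] by simp
    also have "transpose_mat A *\<^sub>v \<dots> = (transpose_mat A * (A * pinv A)) *\<^sub>v v"
      using assoc_mult_mat_vec[OF At mult_carrier_mat[OF A pinv_carrier[OF A]] v] by simp
    finally show ?thesis unfolding pinv_identities(5)[OF A] e by simp
  qed
  have ce: "c e i = l i * c t i" if "i < d" for i using cl(2)[OF t that] eMt by simp
  have Me: "?M *\<^sub>v e \<in> carrier_vec d" using M ec by simp
  have "(sigma_min A)\<^sup>2 * (e \<bullet> e) = (\<Sum>i<d. (l i * ((sigma_min A)\<^sup>2 * l i)) * (c t i)\<^sup>2)"
    using cl(1)[OF ec ec] ce by (simp add: sum_distrib_left power2_eq_square mult_ac)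
  also have "\<dots> \<le> (\<Sum>i<d. (l i * (l i)\<^sup>2) * (c t i)\<^sup>2)"
    using sigma_min_le_eigenvalue[OF cl(3)] eigenvalue_gram_nonneg[OF cl(3)]
    by (intro sum_mono mult_right_mono mult_left_mono) auto
  also have "\<dots> = e \<bullet> (?M *\<^sub>v e)"
    using cl(1)[OF ec Me] cl(2)[OF ec] ce by (simp add: power2_eq_square mult_ac)
  also have "\<dots> = (A *\<^sub>v e) \<bullet> (A *\<^sub>v e)" by (rule gram_scalar_prod[OF A ec ec])
  finally show ?thesis .
qed

section \<open>Norm bounds for a single block\<close>

lemma lambda_max_gram_nonneg:
  fixes R :: "real mat"
  assumes R: "R \<in> carrier_mat r d" and r: "r > 0"
  shows "0 \<le> lambda_max (R * transpose_mat R)"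
proof -
  have Rt: "transpose_mat R \<in> carrier_mat d r" using R by simp
  let ?M = "R * transpose_mat R" and ?u = "unit_vec r 0 :: real vec"
  have M: "?M \<in> carrier_mat r r" and sym: "transpose_mat ?M = ?M"
    using gram_carrier[OF Rt] gram_symmetric[of "transpose_mat R"] by simp_all
  have u: "?u \<in> carrier_vec r" "?u \<bullet> ?u = 1" using r by auto
  have "0 \<le> ?u \<bullet> (?M *\<^sub>v ?u)"
    using gram_scalar_prod[OF Rt u(1) u(1)] scalar_prod_self_nonneg by simp
  also have "\<dots> \<le> lambda_max ?M * (?u \<bullet> ?u)"
    by (rule quadratic_form_le_lambda_max[OF M sym u(1)])
  finally show ?thesis using u(2) by simp
qed

text \<open>The eigenvalue bound concerns \<open>R * transpose_mat R\<close>, so it is applied to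
  \<open>q = R *\<^sub>v y\<close>. The squared norm of \<open>q\<close> is the scalar product of
  \<open>y\<close> with \<open>transpose_mat R *\<^sub>v q\<close>; by Cauchy-Schwarz its square is
  at most \<beta> times the squared norms of \<open>y\<close> and \<open>q\<close>, and one factor
  cancels.\<close>

lemma mult_mat_vec_norm_le:
  fixes R :: "real mat"
  assumes R: "R \<in> carrier_mat r d" and y: "y \<in> carrier_vec d"
    and \<beta>: "lambda_max (R * transpose_mat R) \<le> \<beta>" "0 \<le> \<beta>"
  shows "(R *\<^sub>v y) \<bullet> (R *\<^sub>v y) \<le> \<beta> * (y \<bullet> y)"
proof -
  have Rt: "transpose_mat R \<in> carrier_mat d r" using R by simp
  let ?M = "R * transpose_mat R"
  have M: "?M \<in> carrier_mat r r" and sym: "transpose_mat ?M = ?M"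
    using gram_carrier[OF Rt] gram_symmetric[of "transpose_mat R"] by simp_all
  define q where "q = R *\<^sub>v y"
  have q: "q \<in> carrier_vec r" using R y by (simp add: q_def)
  let ?g = "transpose_mat R *\<^sub>v q"
  have g: "?g \<in> carrier_vec d" using Rt q by simp
  have "?g \<bullet> ?g = q \<bullet> (?M *\<^sub>v q)" using gram_scalar_prod[OF Rt q q] by simp
  also have "\<dots> \<le> lambda_max ?M * (q \<bullet> q)" by (rule quadratic_form_le_lambda_max[OF M sym q])
  also have "\<dots> \<le> \<beta> * (q \<bullet> q)" using \<beta>(1) scalar_prod_self_nonneg by (intro mult_right_mono) auto
  finally have gg: "?g \<bullet> ?g \<le> \<beta> * (q \<bullet> q)" .
  have "(q \<bullet> q)\<^sup>2 = (y \<bullet> ?g)\<^sup>2" using scalar_prod_transpose[OF R y q] by (simp add: q_def)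
  also have "\<dots> \<le> (y \<bullet> y) * (?g \<bullet> ?g)" by (rule scalar_prod_Cauchy[OF y g])
  also have "\<dots> \<le> (y \<bullet> y) * (\<beta> * (q \<bullet> q))" using gg scalar_prod_self_nonneg by (intro mult_left_mono) auto
  finally have *: "(q \<bullet> q) * (q \<bullet> q) \<le> (\<beta> * (y \<bullet> y)) * (q \<bullet> q)" by (simp add: power2_eq_square mult_ac)
  show ?thesis
  proof (cases "q \<bullet> q = 0")
    case True
    then show ?thesis using \<beta>(2) scalar_prod_self_nonneg[of y] by (simp add: q_def)
  next
    case False
    then have "0 < q \<bullet> q" using scalar_prod_self_nonneg[of q] by simp
    then show ?thesis using * by (simp add: q_def)
  qed
qed

text \<open>Pythagoras: a symmetric idempotent matrix is an orthogonal projection.\<close>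

lemma projection_norm:
  fixes P :: "real mat"
  assumes P: "P \<in> carrier_mat n n" "transpose_mat P = P" "P * P = P" and w: "w \<in> carrier_vec n"
  shows "(P *\<^sub>v w) \<bullet> w = (P *\<^sub>v w) \<bullet> (P *\<^sub>v w)"
    "(w - P *\<^sub>v w) \<bullet> (w - P *\<^sub>v w) = w \<bullet> w - (P *\<^sub>v w) \<bullet> (P *\<^sub>v w)"
    "(P *\<^sub>v w) \<bullet> (P *\<^sub>v w) \<le> w \<bullet> w"
proof -
  have Pw: "P *\<^sub>v w \<in> carrier_vec n" using P w by simp
  have "(P *\<^sub>v w) \<bullet> (P *\<^sub>v w) = w \<bullet> (P *\<^sub>v (P *\<^sub>v w))"
    using scalar_prod_transpose[OF P(1) w Pw] P by simp
  also have "P *\<^sub>v (P *\<^sub>v w) = P *\<^sub>v w" using assoc_mult_mat_vec[OF P(1) P(1) w] P(3) by simp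
  finally show 1: "(P *\<^sub>v w) \<bullet> w = (P *\<^sub>v w) \<bullet> (P *\<^sub>v w)" using comm_scalar_prod[OF w Pw] by simp
  show 2: "(w - P *\<^sub>v w) \<bullet> (w - P *\<^sub>v w) = w \<bullet> w - (P *\<^sub>v w) \<bullet> (P *\<^sub>v w)"
    using w Pw 1 comm_scalar_prod[OF w Pw]
    by (simp add: minus_scalar_prod_distrib[of _ n] scalar_prod_minus_distrib[of _ n])
  show "(P *\<^sub>v w) \<bullet> (P *\<^sub>v w) \<le> w \<bullet> w"
    using 2 scalar_prod_self_nonneg[of "w - P *\<^sub>v w"] by simp
qed

lemma pinv_projections:
  fixes C :: "real mat"
  assumes C: "C \<in> carrier_mat n d"
  shows "C * pinv C \<in> carrier_mat n n" "(C * pinv C) * (C * pinv C) = C * pinv C"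
    "pinv C * C \<in> carrier_mat d d" "(pinv C * C) * (pinv C * C) = pinv C * C"
proof -
  note X = pinv_carrier[OF C]
  show "C * pinv C \<in> carrier_mat n n" "pinv C * C \<in> carrier_mat d d" using C X by auto
  show "(C * pinv C) * (C * pinv C) = C * pinv C"
    using assoc_mult_mat[OF mult_carrier_mat[OF C X] C X] pinv_identities(1)[OF C] by simp
  show "(pinv C * C) * (pinv C * C) = pinv C * C"
    using assoc_mult_mat[OF mult_carrier_mat[OF X C] X C] pinv_identities(2)[OF C] by simp
qed

text \<open>The vector \<open>y = pinv R *\<^sub>v q\<close> lies in the row space of
  \<open>R\<close>, so \<open>y = transpose_mat R *\<^sub>v g\<close>, and the eigenvalue bound
  controls \<open>g\<close> by \<open>y\<close>. The squared norm of \<open>y\<close> equals the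
  scalar product of \<open>g\<close> with the projection of \<open>q\<close>, so Cauchy-Schwarz and
  cancellation give the bound.\<close>

lemma pinv_norm_le:
  fixes R :: "real mat"
  assumes R: "R \<in> carrier_mat r d" and q: "q \<in> carrier_vec r"
    and \<alpha>: "\<alpha> \<le> lambda_min (R * transpose_mat R)" "0 < \<alpha>"
  shows "(pinv R *\<^sub>v q) \<bullet> (pinv R *\<^sub>v q) \<le> (q \<bullet> q) / \<alpha>"
proof -
  have Rt: "transpose_mat R \<in> carrier_mat d r" using R by simp
  let ?M = "R * transpose_mat R"
  have M: "?M \<in> carrier_mat r r" and sym: "transpose_mat ?M = ?M"
    using gram_carrier[OF Rt] gram_symmetric[of "transpose_mat R"] by simp_all
  note Y = pinv_carrier[OF R]
  have Yt: "transpose_mat (pinv R) \<in> carrier_mat r d" using Y by simp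
  define y where "y = pinv R *\<^sub>v q"
  have y: "y \<in> carrier_vec d" using Y q by (simp add: y_def)
  define g where "g = transpose_mat (pinv R) *\<^sub>v y"
  have g: "g \<in> carrier_vec r" using Yt y by (simp add: g_def)
  have yg: "y = transpose_mat R *\<^sub>v g"
  proof -
    have "transpose_mat R *\<^sub>v g = (transpose_mat R * transpose_mat (pinv R)) *\<^sub>v y"
      unfolding g_def using assoc_mult_mat_vec[OF Rt Yt y] by simp
    also have "\<dots> = (pinv R * R) *\<^sub>v y"
      using transpose_mult[OF Y R] pinv_identities(4)[OF R] by simp
    also have "\<dots> = (pinv R * R * pinv R) *\<^sub>v q"
      unfolding y_def using assoc_mult_mat_vec[OF mult_carrier_mat[OF Y R] Y q] by simp
    finally show ?thesis using pinv_identities(2)[OF R] y_def by simp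
  qed
  have "\<alpha> * (g \<bullet> g) \<le> lambda_min ?M * (g \<bullet> g)"
    using \<alpha>(1) scalar_prod_self_nonneg by (intro mult_right_mono) auto
  also have "\<dots> \<le> g \<bullet> (?M *\<^sub>v g)" by (rule quadratic_form_ge_lambda_min[OF M sym g])
  also have "\<dots> = y \<bullet> y" using gram_scalar_prod[OF Rt g g] yg by simp
  finally have gg: "g \<bullet> g \<le> (y \<bullet> y) / \<alpha>" using \<alpha>(2) by (simp add: field_simps)
  let ?P = "R * pinv R"
  have Pq: "?P *\<^sub>v q \<in> carrier_vec r" using R Y q by simp
  have Ry: "R *\<^sub>v y = ?P *\<^sub>v q" unfolding y_def using assoc_mult_mat_vec[OF R Y q] by simp
  have "(y \<bullet> y)\<^sup>2 = (g \<bullet> (?P *\<^sub>v q))\<^sup>2"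
    using scalar_prod_transpose[OF Rt g y] Ry yg by simp
  also have "\<dots> \<le> (g \<bullet> g) * ((?P *\<^sub>v q) \<bullet> (?P *\<^sub>v q))" by (rule scalar_prod_Cauchy[OF g Pq])
  also have "\<dots> \<le> ((y \<bullet> y) / \<alpha>) * (q \<bullet> q)"
    using gg projection_norm(3)[OF pinv_projections(1)[OF R] pinv_identities(3)[OF R] pinv_projections(2)[OF R] q]
      scalar_prod_self_nonneg \<alpha>(2) by (intro mult_mono) auto
  finally have *: "(y \<bullet> y) * (y \<bullet> y) \<le> ((q \<bullet> q) / \<alpha>) * (y \<bullet> y)" by (simp add: power2_eq_square mult_ac)
  show ?thesis
  proof (cases "y \<bullet> y = 0")
    case True
    then show ?thesis using \<alpha>(2) scalar_prod_self_nonneg[of q] by (simp add: y_def)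
  next
    case False
    then have "0 < y \<bullet> y" using scalar_prod_self_nonneg[of y] by simp
    then show ?thesis using mult_right_le_imp_le[OF *] by (simp add: y_def)
  qed
qed

section \<open>Blocks and pavings\<close>

text \<open>The inverse sends an element to the number of smaller ones. It is built on the truncated
  index set, whose enumeration agrees with \<open>pick I\<close> on the indices concerned.\<close>

lemma bij_betw_pick:
  "bij_betw (pick I) {..<card {i. i < n \<and> i \<in> I}} {i. i < n \<and> i \<in> I}"
proof -
  let ?J = "{i. i < n \<and> i \<in> I}"
  have "bij_betw (pick ?J) {..<card ?J} ?J"
  proof (rule bij_betw_byWitness[where f' = "\<lambda>a. card {b \<in> ?J. b < a}"])
    show "\<forall>i\<in>{..<card ?J}. card {b \<in> ?J. b < pick ?J i} = i" by (rule ballI, rule card_pick_le) simp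
    show "\<forall>a\<in>?J. pick ?J (card {b \<in> ?J. b < a}) = a" by (intro ballI pick_card_in_set)
    show "pick ?J ` {..<card ?J} \<subseteq> ?J" using pick_in_set_le[of _ ?J] by blast
    have "card {b \<in> ?J. b < a} < card ?J" if "a \<in> ?J" for a
      using that by (intro psubset_card_mono) auto
    then show "(\<lambda>a. card {b \<in> ?J. b < a}) ` ?J \<subseteq> {..<card ?J}" by blast
  qed
  then show ?thesis using pick_reduce_set by (subst bij_betw_cong[of _ _ "pick ?J"]) auto
qed

lemma rows_of_carrier:
  "A \<in> carrier_mat n d \<Longrightarrow> rows_of A I \<in> carrier_mat (card {i. i < n \<and> i \<in> I}) d"
  by (auto simp: rows_of_def submatrix_def)

lemma subvec_carrier:
  "v \<in> carrier_vec n \<Longrightarrow> subvec v I \<in> carrier_vec (card {i. i < n \<and> i \<in> I})"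
  by (auto simp: subvec_def)

lemma row_rows_of:
  assumes "A \<in> carrier_mat n d" "i < card {i. i < n \<and> i \<in> I}"
  shows "row (rows_of A I) i = row A (pick I i)"
  using assms pick_le[OF assms(2)] unfolding rows_of_def
  by (intro eq_vecI) (auto simp: submatrix_def pick_UNIV)

text \<open>Transfers identities such as \<open>A * (pinv A * A) = A\<close> from the whole matrix
  to each block.\<close>

lemma rows_of_mult:
  assumes A: "A \<in> carrier_mat n d" and B: "B \<in> carrier_mat d m"
  shows "rows_of (A * B) I = rows_of A I * B"
proof (rule eq_matI)
  let ?k = "card {i. i < n \<and> i \<in> I}"
  have c: "rows_of (A * B) I \<in> carrier_mat ?k m" "rows_of A I * B \<in> carrier_mat ?k m"
    using A B rows_of_carrier[of "A * B" n m I] rows_of_carrier[OF A, of I] by auto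
  then show "dim_row (rows_of (A * B) I) = dim_row (rows_of A I * B)"
    "dim_col (rows_of (A * B) I) = dim_col (rows_of A I * B)" by auto
  fix i j assume "i < dim_row (rows_of A I * B)" "j < dim_col (rows_of A I * B)"
  then have ij: "i < ?k" "j < m" using c by auto
  have "rows_of (A * B) I $$ (i,j) = (A * B) $$ (pick I i, j)"
    using A B ij by (auto simp: rows_of_def submatrix_def pick_UNIV)
  also have "\<dots> = row (rows_of A I) i \<bullet> col B j"
    using A B ij pick_le[OF ij(1)] by (simp add: row_rows_of)
  also have "\<dots> = (rows_of A I * B) $$ (i,j)" using ij rows_of_carrier[OF A, of I] B by simp
  finally show "rows_of (A * B) I $$ (i,j) = (rows_of A I * B) $$ (i,j)" .
qed

lemma rows_of_mult_vec:
  assumes A: "A \<in> carrier_mat n d"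
  shows "rows_of A I *\<^sub>v x = subvec (A *\<^sub>v x) I"
  using A rows_of_carrier[OF A, of I] pick_le[of _ n I]
  by (intro eq_vecI) (auto simp: subvec_def row_rows_of)

text \<open>Reduces column blocks to row blocks of the transpose, so that one theory of blocks
  serves both kinds of step.\<close>

lemma cols_of_eq: "cols_of A J = transpose_mat (rows_of (transpose_mat A) J)"
  unfolding cols_of_def rows_of_def by (intro eq_matI) (auto simp: submatrix_def pick_UNIV pick_le)

lemma subvec_minus:
  assumes "u \<in> carrier_vec n" "v \<in> carrier_vec n"
  shows "subvec (u - v) I = subvec u I - subvec v I"
  using assms pick_le[of _ n I] by (intro eq_vecI) (auto simp: subvec_def)

lemma subvec_norm:
  assumes v: "v \<in> carrier_vec n" and I: "I \<subseteq> {..<n}"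
  shows "subvec v I \<bullet> subvec v I = (\<Sum>i\<in>I. v $ i * v $ i)"
proof -
  have J: "{i. i < n \<and> i \<in> I} = I" using I by auto
  have "subvec v I \<bullet> subvec v I = (\<Sum>i<card I. v $ pick I i * v $ pick I i)"
    using v J by (simp add: subvec_def scalar_prod_def atLeast0LessThan)
  also have "\<dots> = (\<Sum>i\<in>I. v $ i * v $ i)"
    using sum.reindex_bij_betw[OF bij_betw_pick[of I n, unfolded J], of "\<lambda>i. v $ i * v $ i"] .
  finally show ?thesis .
qed

lemma sum_subvec_norm:
  assumes v: "v \<in> carrier_vec n" and S: "partition_on {..<n} S"
  shows "(\<Sum>I\<in>S. subvec v I \<bullet> subvec v I) = v \<bullet> v"
proof -
  have "I \<subseteq> {..<n}" if "I \<in> S" for I using S that by (auto simp: partition_on_def)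
  then have "(\<Sum>I\<in>S. subvec v I \<bullet> subvec v I) = (\<Sum>I\<in>S. \<Sum>i\<in>I. v $ i * v $ i)"
    by (intro sum.cong refl subvec_norm[OF v])
  also have "\<dots> = (\<Sum>i<n. v $ i * v $ i)" by (rule sum.partition[symmetric]) (use S in auto)
  finally show ?thesis using v by (simp add: scalar_prod_def atLeast0LessThan)
qed

lemma mult_mat_zero_vec: "M \<in> carrier_mat n m \<Longrightarrow> M *\<^sub>v 0\<^sub>v m = 0\<^sub>v n" for M :: "real mat"
  by (intro eq_vecI) auto

lemma transpose_mult_vec_nonzero:
  fixes B :: "real mat"
  assumes B: "B \<in> carrier_mat n d" and B0: "B \<noteq> 0\<^sub>m n d"
  obtains v where "v \<in> carrier_vec n" "transpose_mat B *\<^sub>v v \<noteq> 0\<^sub>v d"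
proof -
  have "\<exists>i j. i < n \<and> j < d \<and> B $$ (i,j) \<noteq> 0"
  proof (rule ccontr)
    assume "\<not> ?thesis"
    then have "B = 0\<^sub>m n d" using B by (intro eq_matI) auto
    then show False using B0 by simp
  qed
  then obtain i j where ij: "i < n" "j < d" "B $$ (i,j) \<noteq> 0" by blast
  have "(transpose_mat B *\<^sub>v unit_vec n i) $ j = B $$ (i,j)" using B ij by simp
  then have "transpose_mat B *\<^sub>v unit_vec n i \<noteq> 0\<^sub>v d" using ij by auto
  then show ?thesis using that[of "unit_vec n i"] by simp
qed

lemma row_paving_partition:
  assumes "B \<in> carrier_mat n d" "row_paving B p \<alpha> \<beta> S"
  shows "partition_on {..<n} S" "finite S" "card S = p"
  using assms finite_elements[of "{..<n}" S] by (auto simp: row_paving_def)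

text \<open>This reassembly is what turns decreases measured block by block into a contraction
  governed by \<open>sigma_min\<close> of the whole matrix.\<close>

lemma sum_rows_of_norm:
  fixes B :: "real mat"
  assumes B: "B \<in> carrier_mat n d" and S: "row_paving B p \<alpha> \<beta> S" and e: "e \<in> carrier_vec d"
  shows "(\<Sum>I\<in>S. (rows_of B I *\<^sub>v e) \<bullet> (rows_of B I *\<^sub>v e)) = (B *\<^sub>v e) \<bullet> (B *\<^sub>v e)"
  unfolding rows_of_mult_vec[OF B]
  using sum_subvec_norm[OF _ row_paving_partition(1)[OF B S]] B e by simp

text \<open>The matrix and the constant \<open>s\<close> are kept general so that the result applies
  to \<open>A\<close> and to its transpose. Testing \<open>s\<close> on a nonzero vector of the row
  space and summing the block bounds yields \<open>s \<le> real p * \<beta>\<close>, which places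
  the rate in the interval from 0 to 1.\<close>

lemma row_paving_rate:
  fixes B :: "real mat"
  assumes B: "B \<in> carrier_mat n d" and B0: "B \<noteq> 0\<^sub>m n d" and S: "row_paving B p \<alpha> \<beta> S"
    and s: "s > 0" "\<And>v. v \<in> carrier_vec n \<Longrightarrow> s * ((transpose_mat B *\<^sub>v v) \<bullet> (transpose_mat B *\<^sub>v v))
        \<le> (B *\<^sub>v (transpose_mat B *\<^sub>v v)) \<bullet> (B *\<^sub>v (transpose_mat B *\<^sub>v v))"
  shows "S \<noteq> {}" "0 < p" "0 < \<beta>" "0 \<le> 1 - s / (real p * \<beta>)" "1 - s / (real p * \<beta>) < 1"
    "\<And>I. I \<in> S \<Longrightarrow> lambda_max (rows_of B I * transpose_mat (rows_of B I)) \<le> \<beta>"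
proof -
  note part = row_paving_partition[OF B S]
  show lm: "lambda_max (rows_of B I * transpose_mat (rows_of B I)) \<le> \<beta>" if "I \<in> S" for I
    using S that by (auto simp: row_paving_def)
  obtain v where v: "v \<in> carrier_vec n" "transpose_mat B *\<^sub>v v \<noteq> 0\<^sub>v d"
    using transpose_mult_vec_nonzero[OF B B0] by blast
  define e where "e = transpose_mat B *\<^sub>v v"
  have e: "e \<in> carrier_vec d" using B v by (simp add: e_def)
  have e0: "0 < e \<bullet> e" using scalar_prod_self_eq_0_iff[OF e] v(2) scalar_prod_self_nonneg[of e] by (simp add: e_def)
  have n0: "n \<noteq> 0"
  proof
    assume "n = 0"
    then have "B = 0\<^sub>m n d" using B by (intro eq_matI) auto
    then show False using B0 by simp
  qed
  show S0: "S \<noteq> {}"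
  proof
    assume "S = {}"
    then have "{..<n} = {}" using partition_onD1[OF part(1)] by simp
    then show False using n0 by (metis lessThan_iff empty_iff not_gr_zero)
  qed
  then show p0: "0 < p" using part(2,3) card_gt_0_iff[of S] by simp
  \<comment> \<open>The norm bound for blocks presupposes a nonnegative \<beta>; this follows from
    any nonempty block, whose \<open>lambda_max\<close> is nonnegative. Strict positivity comes
    later, from \<open>s\<close>.\<close>
  have \<beta>0: "0 \<le> \<beta>"
  proof -
    obtain I where I: "I \<in> S" using S0 by blast
    have "I \<noteq> {}" using partition_onD3[OF part(1)] I by metis
    then obtain i where i: "i \<in> I" by blast
    then have "i < n" using partition_onD1[OF part(1)] I by blast
    then have "i \<in> {i. i < n \<and> i \<in> I}" using i by simp
    then have "0 < card {i. i < n \<and> i \<in> I}" unfolding card_gt_0_iff by (metis (no_types) empty_iff finite_Collect_less_nat finite_Collect_conjI)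
    from order_trans[OF lambda_max_gram_nonneg[OF rows_of_carrier[OF B] this] lm[OF I]]
    show ?thesis .
  qed
  have "s * (e \<bullet> e) \<le> (\<Sum>I\<in>S. (rows_of B I *\<^sub>v e) \<bullet> (rows_of B I *\<^sub>v e))"
    using s(2)[OF v(1)] sum_rows_of_norm[OF B S e] by (simp add: e_def)
  also have "\<dots> \<le> (\<Sum>I\<in>S. \<beta> * (e \<bullet> e))"
    using mult_mat_vec_norm_le[OF rows_of_carrier[OF B] e lm \<beta>0] by (intro sum_mono) auto
  also have "\<dots> = (real p * \<beta>) * (e \<bullet> e)" using part(3) by simp
  finally have sp: "s \<le> real p * \<beta>" using e0 mult_right_le_imp_le by blast
  then show "0 < \<beta>" using s(1) \<beta>0 by (cases "\<beta> = 0") auto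
  then have "0 < real p * \<beta>" using p0 by simp
  then show "0 \<le> 1 - s / (real p * \<beta>)" "1 - s / (real p * \<beta>) < 1" using sp s(1) by (auto simp: field_simps)
qed

section \<open>Expectations of finitely supported laws and scalar recursions\<close>

lemma expectation_bind_le:
  fixes h :: "'b \<Rightarrow> real"
  assumes M: "finite (set_pmf M)" and f: "\<And>s. s \<in> set_pmf M \<Longrightarrow> finite (set_pmf (f s))"
    and le: "\<And>s. s \<in> set_pmf M \<Longrightarrow> measure_pmf.expectation (f s) h \<le> H s"
  shows "measure_pmf.expectation (M \<bind> f) h \<le> measure_pmf.expectation M H"
proof -
  have "measure_pmf.expectation (M \<bind> f) h
      = (\<Sum>s\<in>set_pmf M. pmf M s *\<^sub>R measure_pmf.expectation (f s) h)"
    using M f by (intro pmf_expectation_bind) auto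
  also have "\<dots> \<le> (\<Sum>s\<in>set_pmf M. pmf M s *\<^sub>R H s)"
    using le by (intro sum_mono) (simp add: mult_left_mono)
  also have "\<dots> = measure_pmf.expectation M H"
    by (rule integral_measure_pmf[symmetric]) (use M in auto)
  finally show ?thesis .
qed

text \<open>The constant \<open>C / (1 - \<gamma>)\<close> is the fixed point of the affine map, so
  the induction step reproduces it exactly.\<close>

lemma affine_recursion_bound:
  fixes a :: "nat \<Rightarrow> real"
  assumes \<gamma>: "0 \<le> \<gamma>" "\<gamma> < 1" and C: "0 \<le> C" and a: "\<And>k. a (Suc k) \<le> \<gamma> * a k + C"
  shows "a k \<le> \<gamma> ^ k * a 0 + C / (1 - \<gamma>)"
proof (induction k)
  case 0
  then show ?case using \<gamma> C by simp
next
  case (Suc k)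
  have "a (Suc k) \<le> \<gamma> * (\<gamma> ^ k * a 0 + C / (1 - \<gamma>)) + C"
    using a[of k] mult_left_mono[OF Suc \<gamma>(1)] by linarith
  also have "\<dots> = \<gamma> ^ Suc k * a 0 + C / (1 - \<gamma>)" using \<gamma>(2) by (simp add: field_simps)
  finally show ?case .
qed

lemma geometric_perturbation_bound:
  fixes a :: "nat \<Rightarrow> real"
  assumes \<gamma>: "0 \<le> \<gamma>" "\<gamma> < 1" and \<gamma>': "0 \<le> \<gamma>'" "\<gamma>' \<le> 1" and C: "0 \<le> C"
    and a: "\<And>k. a (Suc k) \<le> \<gamma> * a k + \<gamma>' ^ Suc k * C"
  shows "a N \<le> \<gamma> ^ N * a 0 + (\<gamma> ^ (N div 2) + \<gamma>' ^ (N div 2)) * (C / (1 - \<gamma>))"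
proof -
  \<comment> \<open>The first half is rounded down and the second up, so \<open>m \<le> r\<close>;
    this later allows the exponent \<open>r\<close> of \<gamma> to be lowered to
    \<open>m\<close>.\<close>
  define m r where "m = N div 2" and "r = N - N div 2"
  have N: "N = m + r" and mr: "m \<le> r" by (auto simp: m_def r_def)
  have "a (Suc k) \<le> \<gamma> * a k + C" for k
    using a[of k] mult_right_mono[OF power_le_one[OF \<gamma>', of "Suc k"] C] by simp
  from affine_recursion_bound[of \<gamma> C a, OF \<gamma> C this]
  have 1: "a m \<le> \<gamma> ^ m * a 0 + C / (1 - \<gamma>)" .
  \<comment> \<open>After \<open>m\<close> steps every perturbation has exponent at least
    \<open>m\<close>, so the shifted sequence obeys an affine recursion with the smaller constant
    \<open>\<gamma>' ^ m * C\<close>.\<close>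
  have "a (m + Suc k) \<le> \<gamma> * a (m + k) + \<gamma>' ^ m * C" for k
    using a[of "m + k"] mult_right_mono[OF power_decreasing[of m "Suc (m + k)" \<gamma>', OF _ \<gamma>'] C] by simp
  from affine_recursion_bound[of \<gamma> "\<gamma>' ^ m * C" "\<lambda>k. a (m + k)" r, OF \<gamma> _ this] \<gamma>' C
  have 2: "a N \<le> \<gamma> ^ r * a m + \<gamma>' ^ m * C / (1 - \<gamma>)" by (simp add: N)
  define K where "K = C / (1 - \<gamma>)"
  have K: "0 \<le> K" using \<gamma> C by (simp add: K_def)
  have "a N \<le> \<gamma> ^ r * (\<gamma> ^ m * a 0 + K) + \<gamma>' ^ m * K"
    using 2 mult_left_mono[OF 1 zero_le_power[OF \<gamma>(1), of r]] by (simp add: K_def)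
  also have "\<dots> = \<gamma> ^ N * a 0 + (\<gamma> ^ r + \<gamma>' ^ m) * K"
    unfolding N power_add by (simp add: distrib_left distrib_right)
  also have "\<dots> \<le> \<gamma> ^ N * a 0 + (\<gamma> ^ m + \<gamma>' ^ m) * K"
    using mult_right_mono[OF power_decreasing[OF mr \<gamma>(1)] K] \<gamma>(2) by (simp add: distrib_right)
  finally show ?thesis by (simp add: m_def K_def)
qed

section \<open>The double block iteration\<close>

locale double_block_kaczmarz =
  fixes A :: "real mat" and b :: "real vec" and n d p p' :: nat and \<alpha> \<beta> \<alpha>' \<beta>' :: real
    and S T :: "nat set set"
  assumes A: "A \<in> carrier_mat n d" and A_nonzero: "A \<noteq> 0\<^sub>m n d" and b: "b \<in> carrier_vec n"
    and cols: "col_paving A p' \<alpha>' \<beta>' T"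
    and rows: "row_paving A p \<alpha> \<beta> S" and alpha_pos: "\<alpha> > 0"
begin

definition xls :: "real vec" where "xls = pinv A *\<^sub>v b"
text \<open>The component of \<open>b\<close> orthogonal to the range of \<open>A\<close>. Column
  steps leave it unchanged, so errors of \<open>z\<close> are measured from it.\<close>

definition bperp :: "real vec" where "bperp = b - A *\<^sub>v xls"
definition rate :: real where "rate = 1 - (sigma_min A)\<^sup>2 / (real p * \<beta>)"
definition rate' :: real where "rate' = 1 - (sigma_min A)\<^sup>2 / (real p' * \<beta>')"

lemma pinv_A: "pinv A \<in> carrier_mat d n" using pinv_carrier[OF A] .
lemma transpose_A: "transpose_mat A \<in> carrier_mat d n" using A by simp
lemma xls: "xls \<in> carrier_vec d" using pinv_A b by (simp add: xls_def)
lemma bperp: "bperp \<in> carrier_vec n" using A xls b by (simp add: bperp_def)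
lemma transpose_A_nonzero: "transpose_mat A \<noteq> 0\<^sub>m d n"
  using A_nonzero by (metis transpose_transpose zero_transpose_mat)

text \<open>These are the normal equations for the least squares solution
  \<open>xls\<close>.\<close>

lemma transpose_mult_bperp: "transpose_mat A *\<^sub>v bperp = 0\<^sub>v d"
proof -
  have Axls: "A *\<^sub>v xls = (A * pinv A) *\<^sub>v b" unfolding xls_def using assoc_mult_mat_vec[OF A pinv_A b] by simp
  have "transpose_mat A *\<^sub>v bperp = transpose_mat A *\<^sub>v b - transpose_mat A *\<^sub>v (A *\<^sub>v xls)"
    unfolding bperp_def using A xls by (intro mult_minus_distrib_mat_vec[OF transpose_A b]) auto
  also have "transpose_mat A *\<^sub>v (A *\<^sub>v xls) = (transpose_mat A * (A * pinv A)) *\<^sub>v b"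
    unfolding Axls using assoc_mult_mat_vec[OF transpose_A mult_carrier_mat[OF A pinv_A] b] by simp
  also have "\<dots> = transpose_mat A *\<^sub>v b" using pinv_identities(5)[OF A] by simp
  finally show ?thesis using transpose_A b by simp
qed

lemma
  shows row_paving_facts: "S \<noteq> {}" "0 < p" "0 < \<beta>" "0 \<le> rate" "rate < 1" "finite S" "card S = p"
      "\<And>I. I \<in> S \<Longrightarrow> lambda_max (rows_of A I * transpose_mat (rows_of A I)) \<le> \<beta>"
    and col_paving_facts: "T \<noteq> {}" "0 < p'" "0 < \<beta>'" "0 \<le> rate'" "rate' < 1" "finite T" "card T = p'"
      "\<And>J. J \<in> T \<Longrightarrow> lambda_max (rows_of (transpose_mat A) J * transpose_mat (rows_of (transpose_mat A) J)) \<le> \<beta>'"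
proof -
  have s: "0 < (sigma_min A)\<^sup>2" using sigma_min_pos[OF A A_nonzero] by simp
  note cols' = cols[unfolded col_paving_def]
  from row_paving_rate[OF A A_nonzero rows s sigma_min_le_row_space[OF A _ refl]]
    row_paving_partition[OF A rows]
  show "S \<noteq> {}" "0 < p" "0 < \<beta>" "0 \<le> rate" "rate < 1" "finite S" "card S = p"
      "\<And>I. I \<in> S \<Longrightarrow> lambda_max (rows_of A I * transpose_mat (rows_of A I)) \<le> \<beta>"
    unfolding rate_def by blast+
  \<comment> \<open>For the transpose, the inequality demanded by \<open>row_paving_rate\<close> is
    the range estimate for \<open>A\<close>, so both rates refer to the same
    \<open>sigma_min A\<close>.\<close>
  have "(sigma_min A)\<^sup>2 * ((transpose_mat (transpose_mat A) *\<^sub>v v) \<bullet> (transpose_mat (transpose_mat A) *\<^sub>v v))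
        \<le> (transpose_mat A *\<^sub>v (transpose_mat (transpose_mat A) *\<^sub>v v)) \<bullet>
          (transpose_mat A *\<^sub>v (transpose_mat (transpose_mat A) *\<^sub>v v))" if "v \<in> carrier_vec d" for v
    using sigma_min_le_range[OF A that refl] by simp
  from row_paving_rate[OF transpose_A transpose_A_nonzero cols' s this] row_paving_partition[OF transpose_A cols']
  show "T \<noteq> {}" "0 < p'" "0 < \<beta>'" "0 \<le> rate'" "rate' < 1" "finite T" "card T = p'"
      "\<And>J. J \<in> T \<Longrightarrow> lambda_max (rows_of (transpose_mat A) J * transpose_mat (rows_of (transpose_mat A) J)) \<le> \<beta>'"
    unfolding rate'_def by blast+
qed

section \<open>Invariant subspaces and the effect of a single step\<close>

definition in_range :: "real vec \<Rightarrow> bool" where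
  "in_range w \<longleftrightarrow> w \<in> carrier_vec n \<and> (A * pinv A) *\<^sub>v w = w"

text \<open>Both subspaces are encoded as fixed points of their orthogonal projections, so that
  closure under sums and differences follows from linearity of the matrix product.\<close>

definition in_row_space :: "real vec \<Rightarrow> bool" where
  "in_row_space e \<longleftrightarrow> e \<in> carrier_vec d \<and> (pinv A * A) *\<^sub>v e = e"

lemma sigma_min_in_range:
  assumes "in_range w"
  shows "(sigma_min A)\<^sup>2 * (w \<bullet> w) \<le> (transpose_mat A *\<^sub>v w) \<bullet> (transpose_mat A *\<^sub>v w)"
proof (rule sigma_min_le_range[OF A])
  show "pinv A *\<^sub>v w \<in> carrier_vec d" using assms pinv_A by (simp add: in_range_def)
  show "w = A *\<^sub>v (pinv A *\<^sub>v w)"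
    using assms assoc_mult_mat_vec[OF A pinv_A] unfolding in_range_def by metis
qed

lemma sigma_min_in_row_space:
  assumes "in_row_space e"
  shows "(sigma_min A)\<^sup>2 * (e \<bullet> e) \<le> (A *\<^sub>v e) \<bullet> (A *\<^sub>v e)"
proof (rule sigma_min_le_row_space[OF A])
  have Xt: "transpose_mat (pinv A) \<in> carrier_mat n d" using pinv_A by simp
  show "transpose_mat (pinv A) *\<^sub>v e \<in> carrier_vec n" using assms pinv_A by (simp add: in_row_space_def)
  have "pinv A * A = transpose_mat A * transpose_mat (pinv A)"
    using transpose_mult[OF pinv_A A] pinv_identities(4)[OF A] by simp
  then show "e = transpose_mat A *\<^sub>v (transpose_mat (pinv A) *\<^sub>v e)"
    using assms assoc_mult_mat_vec[OF transpose_A Xt] unfolding in_row_space_def by metis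
qed

text \<open>The block projection \<open>P\<close> annihilates \<open>bperp\<close>, hence the
  residual becomes \<open>w - P *\<^sub>v w\<close>. The block matrix \<open>D\<close> sees only
  \<open>P *\<^sub>v w\<close>, so the squared norm of \<open>D *\<^sub>v w\<close> is at most
  \<beta>' times that of \<open>P *\<^sub>v w\<close>, and Pythagoras gives the decrease.\<close>

lemma z_step_residual:
  assumes J: "J \<in> T" and z: "z \<in> carrier_vec n" and w: "in_range (z - bperp)"
  defines "w \<equiv> z - bperp" and "w' \<equiv> z_step A J z - bperp"
  shows "z_step A J z \<in> carrier_vec n" "in_range w'"
    "w' \<bullet> w' \<le> w \<bullet> w - ((rows_of (transpose_mat A) J *\<^sub>v w) \<bullet> (rows_of (transpose_mat A) J *\<^sub>v w)) / \<beta>'"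
proof -
  let ?t = "card {j. j < d \<and> j \<in> J}"
  define D where "D = rows_of (transpose_mat A) J"
  have D: "D \<in> carrier_mat ?t n" unfolding D_def by (rule rows_of_carrier[OF transpose_A])
  define C where "C = transpose_mat D"
  have C: "C \<in> carrier_mat n ?t" using D by (simp add: C_def)
  have CD: "transpose_mat C = D" by (simp add: C_def)
  note Ci = pinv_carrier[OF C]
  define P where "P = C * pinv C"
  have P: "P \<in> carrier_mat n n" "transpose_mat P = P" "P * P = P"
    unfolding P_def using pinv_projections[OF C] pinv_identities(3)[OF C] by auto
  have wc: "w \<in> carrier_vec n" using assms by (simp add: in_range_def)
  have zw: "z = bperp + w" unfolding w_def using z bperp by (intro eq_vecI) auto
  have "D *\<^sub>v bperp = subvec (transpose_mat A *\<^sub>v bperp) J"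
    unfolding D_def by (rule rows_of_mult_vec[OF transpose_A])
  also have "\<dots> = 0\<^sub>v ?t" unfolding transpose_mult_bperp
    by (intro eq_vecI) (auto simp: subvec_def pick_le)
  finally have Db: "D *\<^sub>v bperp = 0\<^sub>v ?t" .
  have Cit: "transpose_mat (pinv C) \<in> carrier_mat n ?t" using Ci by simp
  have C0: "transpose_mat (pinv C) *\<^sub>v 0\<^sub>v ?t = 0\<^sub>v n" using Cit by (rule mult_mat_zero_vec)
  \<comment> \<open>By symmetry \<open>P\<close> factors through \<open>D\<close>, the transpose of
    the column block, which annihilates \<open>bperp\<close>.\<close>
  have "P *\<^sub>v bperp = (transpose_mat (pinv C) * D) *\<^sub>v bperp"
    using P(2) transpose_mult[OF C Ci] CD unfolding P_def by simp
  also have "\<dots> = 0\<^sub>v n" using assoc_mult_mat_vec[OF Cit D bperp] Db C0 by simp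
  finally have Pb: "P *\<^sub>v bperp = 0\<^sub>v n" .
  have Pw: "P *\<^sub>v w \<in> carrier_vec n" using P wc by simp
  have "z_step A J z = z - P *\<^sub>v z"
    unfolding z_step_def cols_of_eq D_def[symmetric] C_def[symmetric] P_def
    using assoc_mult_mat_vec[OF C Ci z] by simp
  also have "P *\<^sub>v z = P *\<^sub>v w"
    unfolding zw using mult_add_distrib_mat_vec[OF P(1) bperp wc] Pb Pw by simp
  finally have zs: "z_step A J z = z - P *\<^sub>v w" .
  then show "z_step A J z \<in> carrier_vec n" using z Pw by simp
  have w': "w' = w - P *\<^sub>v w" unfolding w'_def zs unfolding w_def using z bperp Pw[unfolded w_def]
    by (intro eq_vecI) (use P(1) in auto)
  \<comment> \<open>The columns of a block lie in the range of \<open>A\<close>, so subtracting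
    their projection does not leave the range.\<close>
  have "D * (A * pinv A) = D" unfolding D_def
    using rows_of_mult[OF transpose_A mult_carrier_mat[OF A pinv_A], of J] pinv_identities(5)[OF A] by simp
  then have AXC: "(A * pinv A) * C = C"
    using transpose_mult[OF D mult_carrier_mat[OF A pinv_A]] pinv_identities(3)[OF A] by (simp add: C_def)
  have AX: "A * pinv A \<in> carrier_mat n n" using A pinv_A by simp
  have "(A * pinv A) * P = P" unfolding P_def using assoc_mult_mat[OF AX C Ci] AXC by simp
  then have "(A * pinv A) *\<^sub>v (P *\<^sub>v w) = P *\<^sub>v w" using assoc_mult_mat_vec[OF AX P(1) wc] by simp
  then show "in_range w'" unfolding w' in_range_def
    using mult_minus_distrib_mat_vec[OF AX wc Pw] assms(3) wc Pw by (simp add: in_range_def w_def)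
  have "D *\<^sub>v (P *\<^sub>v w) = (D * P) *\<^sub>v w" using assoc_mult_mat_vec[OF D P(1) wc] by simp
  also have "D * P = D" unfolding P_def using pinv_identities(5)[OF C] CD by simp
  finally have "(D *\<^sub>v w) \<bullet> (D *\<^sub>v w) \<le> \<beta>' * ((P *\<^sub>v w) \<bullet> (P *\<^sub>v w))"
    using mult_mat_vec_norm_le[OF D Pw col_paving_facts(8)[OF J, folded D_def]] col_paving_facts(3) by simp
  then have "((D *\<^sub>v w) \<bullet> (D *\<^sub>v w)) / \<beta>' \<le> (P *\<^sub>v w) \<bullet> (P *\<^sub>v w)"
    using col_paving_facts(3) by (simp add: field_simps)
  then show "w' \<bullet> w' \<le> w \<bullet> w - ((rows_of (transpose_mat A) J *\<^sub>v w) \<bullet> (rows_of (transpose_mat A) J *\<^sub>v w)) / \<beta>'"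
    unfolding w' projection_norm(2)[OF P wc] D_def[symmetric] by simp
qed

text \<open>The new error is the part of \<open>e\<close> in the kernel of the block plus
  \<open>Y *\<^sub>v q\<close>, which lies in the row space of the block. These are orthogonal: the
  first summand loses \<open>P *\<^sub>v e\<close>, bounded below through \<beta>, and the second is
  bounded through \<alpha> by \<open>pinv_norm_le\<close>.\<close>

lemma x_step_error:
  assumes I: "I \<in> S" and x: "x \<in> carrier_vec d" and z: "z \<in> carrier_vec n" and e: "in_row_space (x - xls)"
  defines "e \<equiv> x - xls" and "w \<equiv> z - bperp" and "e' \<equiv> x_step A b I z x - xls"
  shows "x_step A b I z x \<in> carrier_vec d" "in_row_space e'"
    "e' \<bullet> e' \<le> e \<bullet> e - ((rows_of A I *\<^sub>v e) \<bullet> (rows_of A I *\<^sub>v e)) / \<beta>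
        + (subvec (- w) I \<bullet> subvec (- w) I) / \<alpha>"
proof -
  let ?r = "card {i. i < n \<and> i \<in> I}"
  define R where "R = rows_of A I"
  have R: "R \<in> carrier_mat ?r d" unfolding R_def by (rule rows_of_carrier[OF A])
  have Rt: "transpose_mat R \<in> carrier_mat d ?r" using R by simp
  define Y where "Y = pinv R"
  have Y: "Y \<in> carrier_mat d ?r" unfolding Y_def by (rule pinv_carrier[OF R])
  have Yt: "transpose_mat Y \<in> carrier_mat ?r d" using Y by simp
  define P where "P = Y * R"
  have P: "P \<in> carrier_mat d d" "transpose_mat P = P" "P * P = P"
    unfolding P_def Y_def using pinv_projections[OF R] pinv_identities(4)[OF R] by auto
  have ec: "e \<in> carrier_vec d" using x xls by (simp add: e_def)
  have wc: "w \<in> carrier_vec n" using z bperp by (simp add: w_def)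
  have Ax: "A *\<^sub>v x \<in> carrier_vec n" "A *\<^sub>v xls \<in> carrier_vec n" "A *\<^sub>v e \<in> carrier_vec n"
    using A x xls ec by auto
  define q where "q = subvec (- w) I"
  have q: "q \<in> carrier_vec ?r" unfolding q_def using wc by (intro subvec_carrier) simp
  have Yq: "Y *\<^sub>v q \<in> carrier_vec d" using Y q by simp
  have Re: "R *\<^sub>v e \<in> carrier_vec ?r" using R ec by simp
  have Pe: "P *\<^sub>v e \<in> carrier_vec d" using P ec by simp
  \<comment> \<open>Since \<open>b\<close> is \<open>bperp\<close> plus
    \<open>A *\<^sub>v xls\<close>, subtracting \<open>z\<close> removes the inconsistent part of
    \<open>b\<close> and leaves only the residual \<open>w\<close> as perturbation.\<close>
  have "b - z - A *\<^sub>v x = - w - A *\<^sub>v e"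
  proof -
    have Ae: "A *\<^sub>v e = A *\<^sub>v x - A *\<^sub>v xls" unfolding e_def by (rule mult_minus_distrib_mat_vec[OF A x xls])
    show ?thesis unfolding Ae w_def bperp_def using b z Ax A
      by (intro eq_vecI) auto
  qed
  moreover have "subvec b I - subvec z I - R *\<^sub>v x = subvec (b - z - A *\<^sub>v x) I"
    unfolding R_def rows_of_mult_vec[OF A] using b z Ax by (simp add: subvec_minus[of _ n])
  moreover have "subvec (- w - A *\<^sub>v e) I = q - R *\<^sub>v e"
    unfolding R_def rows_of_mult_vec[OF A] q_def using wc Ax by (intro subvec_minus) auto
  ultimately have "x_step A b I z x = x + Y *\<^sub>v (q - R *\<^sub>v e)"
    unfolding x_step_def R_def[symmetric] Y_def by simp
  also have "Y *\<^sub>v (q - R *\<^sub>v e) = Y *\<^sub>v q - P *\<^sub>v e"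
    unfolding P_def using mult_minus_distrib_mat_vec[OF Y q Re] assoc_mult_mat_vec[OF Y R ec] by simp
  finally have xs: "x_step A b I z x = x + (Y *\<^sub>v q - P *\<^sub>v e)" .
  then show "x_step A b I z x \<in> carrier_vec d" using x Yq Pe by simp
  define u where "u = e - P *\<^sub>v e"
  have u: "u \<in> carrier_vec d" using ec Pe by (simp add: u_def)
  have e': "e' = u + Y *\<^sub>v q"
    unfolding e'_def xs u_def unfolding e_def using x xls Yq Pe[unfolded e_def] P(1) Y
    by (intro eq_vecI) auto
  have PY: "P * Y = Y" unfolding P_def Y_def by (rule pinv_identities(2)[OF R])
  have PYq: "P *\<^sub>v (Y *\<^sub>v q) = Y *\<^sub>v q" using assoc_mult_mat_vec[OF P(1) Y q] PY by simp
  have Pu: "P *\<^sub>v u = 0\<^sub>v d"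
    unfolding u_def using mult_minus_distrib_mat_vec[OF P(1) ec Pe] assoc_mult_mat_vec[OF P(1) P(1) ec] P(3) Pe by simp
  \<comment> \<open>\<open>P\<close> fixes \<open>Y *\<^sub>v q\<close> and annihilates
    \<open>u\<close>, so moving the symmetric \<open>P\<close> across the product shows
    orthogonality.\<close>
  have "u \<bullet> (Y *\<^sub>v q) = (P *\<^sub>v u) \<bullet> (Y *\<^sub>v q)"
    using scalar_prod_transpose[OF P(1) u Yq] P(2) PYq by simp
  then have orth: "u \<bullet> (Y *\<^sub>v q) = 0" using Pu Yq by simp
  have "e' \<bullet> e' = u \<bullet> u + (Y *\<^sub>v q) \<bullet> (Y *\<^sub>v q)"
    unfolding e' using u Yq orth comm_scalar_prod[OF u Yq]
    by (simp add: add_scalar_prod_distrib[of _ d] scalar_prod_add_distrib[of _ d])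
  moreover have "u \<bullet> u = e \<bullet> e - (P *\<^sub>v e) \<bullet> (P *\<^sub>v e)" unfolding u_def by (rule projection_norm(2)[OF P ec])
  moreover have "(Y *\<^sub>v q) \<bullet> (Y *\<^sub>v q) \<le> (q \<bullet> q) / \<alpha>"
    unfolding Y_def using rows I alpha_pos by (intro pinv_norm_le[OF R q]) (auto simp: row_paving_def R_def)
  moreover have "((R *\<^sub>v e) \<bullet> (R *\<^sub>v e)) / \<beta> \<le> (P *\<^sub>v e) \<bullet> (P *\<^sub>v e)"
  proof -
    have "R *\<^sub>v (P *\<^sub>v e) = (R * P) *\<^sub>v e" using assoc_mult_mat_vec[OF R P(1) ec] by simp
    also have "R * P = R" unfolding P_def Y_def
      using assoc_mult_mat[OF R pinv_carrier[OF R] R] pinv_identities(1)[OF R] by simp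
    finally have "(R *\<^sub>v e) \<bullet> (R *\<^sub>v e) \<le> \<beta> * ((P *\<^sub>v e) \<bullet> (P *\<^sub>v e))"
      using mult_mat_vec_norm_le[OF R Pe row_paving_facts(8)[OF I, folded R_def]] row_paving_facts(3) by simp
    then show ?thesis using row_paving_facts(3) by (simp add: field_simps)
  qed
  ultimately show "e' \<bullet> e' \<le> e \<bullet> e - ((rows_of A I *\<^sub>v e) \<bullet> (rows_of A I *\<^sub>v e)) / \<beta>
        + (subvec (- w) I \<bullet> subvec (- w) I) / \<alpha>"
    unfolding R_def[symmetric] q_def by linarith
  have XA: "pinv A * A \<in> carrier_mat d d" using A pinv_A by simp
  \<comment> \<open>The row space of a block lies in that of \<open>A\<close>, so both corrections
    to \<open>e\<close> stay in the row space of \<open>A\<close>.\<close>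
  have "R * (pinv A * A) = R" unfolding R_def
    using rows_of_mult[OF A XA, of I] pinv_identities(1)[OF A] assoc_mult_mat[OF A pinv_A A] by simp
  then have XARt: "(pinv A * A) * transpose_mat R = transpose_mat R"
    using transpose_mult[OF R XA] pinv_identities(4)[OF A] by simp
  have "P = transpose_mat R * transpose_mat Y" using P(2) transpose_mult[OF Y R] by (simp add: P_def)
  then have XAP: "(pinv A * A) * P = P" using assoc_mult_mat[OF XA Rt Yt] XARt by simp
  then have "(pinv A * A) * Y = Y" using assoc_mult_mat[OF XA P(1) Y] PY by simp
  then have 1: "(pinv A * A) *\<^sub>v (Y *\<^sub>v q) = Y *\<^sub>v q" using assoc_mult_mat_vec[OF XA Y q] by simp
  have 2: "(pinv A * A) *\<^sub>v (P *\<^sub>v e) = P *\<^sub>v e" using assoc_mult_mat_vec[OF XA P(1) ec] XAP by simp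
  have 3: "(pinv A * A) *\<^sub>v e = e" using assms(4) by (simp add: in_row_space_def e_def)
  show "in_row_space e'" unfolding in_row_space_def e'
    using mult_add_distrib_mat_vec[OF XA u Yq] mult_minus_distrib_mat_vec[OF XA ec Pe] 1 2 3 u Yq
    by (simp add: u_def)
qed


section \<open>Averages over a uniformly chosen block\<close>

lemma z_step_mean:
  assumes z: "z \<in> carrier_vec n" and w: "in_range (z - bperp)"
  shows "(\<Sum>J\<in>T. (z_step A J z - bperp) \<bullet> (z_step A J z - bperp)) / real p' \<le> rate' * ((z - bperp) \<bullet> (z - bperp))"
proof -
  let ?w = "z - bperp"
  have wc: "?w \<in> carrier_vec n" using z bperp by simp
  let ?D = "\<lambda>J. (rows_of (transpose_mat A) J *\<^sub>v ?w) \<bullet> (rows_of (transpose_mat A) J *\<^sub>v ?w)"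
  have "(\<Sum>J\<in>T. (z_step A J z - bperp) \<bullet> (z_step A J z - bperp)) \<le> (\<Sum>J\<in>T. ?w \<bullet> ?w - ?D J / \<beta>')"
    using z_step_residual(3)[OF _ z w] by (intro sum_mono) auto
  also have "\<dots> = real p' * (?w \<bullet> ?w) - (\<Sum>J\<in>T. ?D J) / \<beta>'"
    by (simp add: sum_subtractf col_paving_facts(7) sum_divide_distrib)
  also have "(\<Sum>J\<in>T. ?D J) = (transpose_mat A *\<^sub>v ?w) \<bullet> (transpose_mat A *\<^sub>v ?w)"
    by (rule sum_rows_of_norm[OF transpose_A cols[unfolded col_paving_def] wc])
  also have "real p' * (?w \<bullet> ?w) - \<dots> / \<beta>' \<le> real p' * (?w \<bullet> ?w) - ((sigma_min A)\<^sup>2 * (?w \<bullet> ?w)) / \<beta>'"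
    using divide_right_mono[OF sigma_min_in_range[OF w], of \<beta>'] col_paving_facts(3) by simp
  also have "\<dots> = (rate' * (?w \<bullet> ?w)) * real p'"
    using col_paving_facts(2,3) by (simp add: rate'_def field_simps)
  finally show ?thesis using col_paving_facts(2) by (simp add: pos_divide_le_eq)
qed

lemma x_step_mean:
  assumes x: "x \<in> carrier_vec d" and z: "z \<in> carrier_vec n" and e: "in_row_space (x - xls)"
  shows "(\<Sum>I\<in>S. (x_step A b I z x - xls) \<bullet> (x_step A b I z x - xls)) / real p
      \<le> rate * ((x - xls) \<bullet> (x - xls)) + ((z - bperp) \<bullet> (z - bperp)) / \<alpha>"
proof -
  let ?e = "x - xls" and ?w = "z - bperp"
  have ec: "?e \<in> carrier_vec d" and wc: "- ?w \<in> carrier_vec n" using x z xls bperp by auto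
  have ww: "(- ?w) \<bullet> (- ?w) = ?w \<bullet> ?w" using z bperp
    by (auto simp: scalar_prod_def algebra_simps intro!: sum.cong)
  let ?R = "\<lambda>I. (rows_of A I *\<^sub>v ?e) \<bullet> (rows_of A I *\<^sub>v ?e)"
  let ?v = "\<lambda>I. subvec (- ?w) I \<bullet> subvec (- ?w) I"
  have "(\<Sum>I\<in>S. (x_step A b I z x - xls) \<bullet> (x_step A b I z x - xls))
      \<le> (\<Sum>I\<in>S. ?e \<bullet> ?e - ?R I / \<beta> + ?v I / \<alpha>)"
    using x_step_error(3)[OF _ x z e] by (intro sum_mono) auto
  also have "\<dots> = real p * (?e \<bullet> ?e) - (\<Sum>I\<in>S. ?R I) / \<beta> + (\<Sum>I\<in>S. ?v I) / \<alpha>"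
    by (simp add: sum.distrib sum_subtractf row_paving_facts(7) sum_divide_distrib)
  also have "(\<Sum>I\<in>S. ?R I) = (A *\<^sub>v ?e) \<bullet> (A *\<^sub>v ?e)" by (rule sum_rows_of_norm[OF A rows ec])
  also have "(\<Sum>I\<in>S. ?v I) = ?w \<bullet> ?w"
    using sum_subvec_norm[OF wc row_paving_partition(1)[OF A rows]] ww by simp
  \<comment> \<open>Averaging would even divide the perturbation by \<open>real p\<close>; this gain
    is given up through \<open>1 \<le> real p\<close>, which yields the form used in the final
    bound.\<close>
  also have "real p * (?e \<bullet> ?e) - ((A *\<^sub>v ?e) \<bullet> (A *\<^sub>v ?e)) / \<beta> + (?w \<bullet> ?w) / \<alpha>
      \<le> real p * (?e \<bullet> ?e) - ((sigma_min A)\<^sup>2 * (?e \<bullet> ?e)) / \<beta> + real p * ((?w \<bullet> ?w) / \<alpha>)"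
  proof (intro add_mono diff_left_mono)
    show "((sigma_min A)\<^sup>2 * (?e \<bullet> ?e)) / \<beta> \<le> ((A *\<^sub>v ?e) \<bullet> (A *\<^sub>v ?e)) / \<beta>"
      using divide_right_mono[OF sigma_min_in_row_space[OF e], of \<beta>] row_paving_facts(3) by simp
    have "0 \<le> (?w \<bullet> ?w) / \<alpha>" using scalar_prod_self_nonneg[of ?w] alpha_pos by simp
    moreover have "1 \<le> real p" using row_paving_facts(2) by simp
    ultimately show "(?w \<bullet> ?w) / \<alpha> \<le> real p * ((?w \<bullet> ?w) / \<alpha>)"
      using mult_right_mono[of 1 "real p" "(?w \<bullet> ?w) / \<alpha>"] by (simp only: mult_1_left)
  qed
  also have "\<dots> = (rate * (?e \<bullet> ?e) + (?w \<bullet> ?w) / \<alpha>) * real p"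
    using row_paving_facts(2,3) by (simp add: rate_def left_diff_distrib distrib_right)
  finally show ?thesis using row_paving_facts(2) by (simp add: pos_divide_le_eq)
qed

section \<open>The Markov chain of iterates and its expected errors\<close>

definition step :: "real vec \<times> real vec \<Rightarrow> (real vec \<times> real vec) pmf" where
  "step s = pmf_of_set T \<bind> (\<lambda>J. map_pmf
     (\<lambda>I. (x_step A b I (z_step A J (snd s)) (fst s), z_step A J (snd s))) (pmf_of_set S))"

text \<open>Exhibits the iteration as a Markov chain with transition kernel \<open>step\<close>, so
  that expectations can be estimated one transition at a time.\<close>

lemma rdbk_state_Suc: "rdbk_state A b T S (Suc k) = rdbk_state A b T S k \<bind> step"
  by (simp add: step_def[abs_def] map_pmf_def Let_def case_prod_beta')

lemma finite_set_pmf_step: "finite (set_pmf (step s))"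
  using row_paving_facts(1,6) col_paving_facts(1,6) by (simp add: step_def)

lemma expectation_step:
  "measure_pmf.expectation (step s) h
    = (\<Sum>J\<in>T. (\<Sum>I\<in>S. h (x_step A b I (z_step A J (snd s)) (fst s), z_step A J (snd s))) / real p) / real p'"
  for h :: "_ \<Rightarrow> real"
  unfolding step_def using row_paving_facts(1,6,7) col_paving_facts(1,6,7)
  by (subst pmf_expectation_bind_pmf_of_set)
     (auto simp: integral_pmf_of_set sum_divide_distrib sum_distrib_left divide_inverse mult_ac)

text \<open>The invariant along every sample path: both errors stay in the subspaces where the lower
  bounds by \<open>sigma_min\<close> hold.\<close>

definition admissible :: "real vec \<times> real vec \<Rightarrow> bool" where
  "admissible s \<longleftrightarrow> fst s \<in> carrier_vec d \<and> in_row_space (fst s - xls) \<and>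
     snd s \<in> carrier_vec n \<and> in_range (snd s - bperp)"

lemma admissible_step:
  assumes "admissible s" "s' \<in> set_pmf (step s)"
  shows "admissible s'"
proof -
  obtain J I where JI: "J \<in> T" "I \<in> S"
    and s': "s' = (x_step A b I (z_step A J (snd s)) (fst s), z_step A J (snd s))"
    using assms(2) row_paving_facts(1,6) col_paving_facts(1,6) by (auto simp: step_def)
  show ?thesis using assms(1) z_step_residual(1,2)[OF JI(1)] x_step_error(1,2)[OF JI(2)]
    unfolding s' admissible_def by simp
qed

text \<open>Starting at zero makes the initial error the negative of \<open>xls\<close>, which lies
  in the row space because \<open>xls\<close> is an image of \<open>pinv A\<close>.\<close>

lemma admissible_init: "admissible (0\<^sub>v d, b)"
proof -
  have bR: "A *\<^sub>v xls \<in> carrier_vec n" using A xls by simp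
  have z: "b - bperp = A *\<^sub>v xls" unfolding bperp_def using b bR A by (intro eq_vecI) auto
  have XA: "pinv A * A \<in> carrier_mat d d" and AX: "A * pinv A \<in> carrier_mat n n" using A pinv_A by auto
  have 1: "(pinv A * A) *\<^sub>v xls = xls" unfolding xls_def
    using assoc_mult_mat_vec[OF XA pinv_A b] pinv_identities(2)[OF A] by simp
  have 2: "(A * pinv A) *\<^sub>v (A *\<^sub>v xls) = A *\<^sub>v xls"
    using assoc_mult_mat_vec[OF AX A xls] pinv_identities(1)[OF A] by simp
  have "(pinv A * A) *\<^sub>v 0\<^sub>v d = 0\<^sub>v d" using XA by (rule mult_mat_zero_vec)
  then have "(pinv A * A) *\<^sub>v (0\<^sub>v d - xls) = 0\<^sub>v d - xls"
    using mult_minus_distrib_mat_vec[OF XA _ xls, of "0\<^sub>v d"] 1 by simp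
  then show ?thesis using xls b z 2 bR by (simp add: admissible_def in_row_space_def in_range_def)
qed

lemma rdbk_state_finite_admissible:
  "finite (set_pmf (rdbk_state A b T S k)) \<and> (\<forall>s\<in>set_pmf (rdbk_state A b T S k). admissible s)"
proof (induction k)
  case 0
  then show ?case using A admissible_init by simp
next
  case (Suc k)
  then show ?case unfolding rdbk_state_Suc using finite_set_pmf_step admissible_step by auto
qed

definition z_err :: "real vec \<times> real vec \<Rightarrow> real" where
  "z_err s = (snd s - bperp) \<bullet> (snd s - bperp)"

definition x_err :: "real vec \<times> real vec \<Rightarrow> real" where
  "x_err s = (fst s - xls) \<bullet> (fst s - xls)"

lemma expectation_step_z_err:
  assumes "admissible s"
  shows "measure_pmf.expectation (step s) z_err \<le> rate' * z_err s"
  using z_step_mean[of "snd s"] assms row_paving_facts(2,7)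
  unfolding expectation_step by (simp add: admissible_def z_err_def)

text \<open>The update of \<open>x\<close> uses the freshly updated \<open>z\<close>, so the
  perturbation has already contracted once on average; this is the origin of the factor
  \<open>rate'\<close> here and of the exponent \<open>Suc k\<close> in the recursion.\<close>

lemma expectation_step_x_err:
  assumes s: "admissible s"
  shows "measure_pmf.expectation (step s) x_err \<le> rate * x_err s + rate' * z_err s / \<alpha>"
proof -
  let ?z = "\<lambda>J. z_step A J (snd s)"
  have "(\<Sum>J\<in>T. (\<Sum>I\<in>S. x_err (x_step A b I (?z J) (fst s), ?z J)) / real p)
      \<le> (\<Sum>J\<in>T. rate * x_err s + ((?z J - bperp) \<bullet> (?z J - bperp)) / \<alpha>)"
    using s x_step_mean z_step_residual(1)[of _ "snd s"]
    by (intro sum_mono) (auto simp: x_err_def admissible_def)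
  also have "\<dots> = real p' * (rate * x_err s) + (\<Sum>J\<in>T. (?z J - bperp) \<bullet> (?z J - bperp)) / \<alpha>"
    by (simp add: sum.distrib col_paving_facts(7) sum_divide_distrib)
  finally have "measure_pmf.expectation (step s) x_err
      \<le> (real p' * (rate * x_err s) + (\<Sum>J\<in>T. (?z J - bperp) \<bullet> (?z J - bperp)) / \<alpha>) / real p'"
    unfolding expectation_step by (intro divide_right_mono) auto
  also have "\<dots> = rate * x_err s + ((\<Sum>J\<in>T. (?z J - bperp) \<bullet> (?z J - bperp)) / real p') / \<alpha>"
    using col_paving_facts(2) by (simp add: add_divide_distrib)
  also have "\<dots> \<le> rate * x_err s + rate' * z_err s / \<alpha>"
    using z_step_mean[of "snd s"] s alpha_pos
    by (intro add_left_mono divide_right_mono) (auto simp: admissible_def z_err_def)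
  finally show ?thesis .
qed

lemma expectation_z_err:
  "measure_pmf.expectation (rdbk_state A b T S k) z_err \<le> rate' ^ k * z_err (0\<^sub>v d, b)"
proof (induction k)
  case 0
  then show ?case using A by simp
next
  case (Suc k)
  have "measure_pmf.expectation (rdbk_state A b T S (Suc k)) z_err
      \<le> measure_pmf.expectation (rdbk_state A b T S k) (\<lambda>s. rate' * z_err s)"
    unfolding rdbk_state_Suc using rdbk_state_finite_admissible finite_set_pmf_step expectation_step_z_err
    by (intro expectation_bind_le) auto
  also have "\<dots> = rate' * measure_pmf.expectation (rdbk_state A b T S k) z_err" by simp
  also have "\<dots> \<le> rate' * (rate' ^ k * z_err (0\<^sub>v d, b))" by (rule mult_left_mono[OF Suc col_paving_facts(4)])
  finally show ?case by simp
qed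

lemma expectation_x_err_Suc:
  "measure_pmf.expectation (rdbk_state A b T S (Suc k)) x_err
    \<le> rate * measure_pmf.expectation (rdbk_state A b T S k) x_err + rate' ^ Suc k * (z_err (0\<^sub>v d, b) / \<alpha>)"
proof -
  let ?M = "rdbk_state A b T S k"
  have int: "integrable ?M f" for f :: "_ \<Rightarrow> real"
    using rdbk_state_finite_admissible by (intro integrable_measure_pmf_finite) auto
  have "measure_pmf.expectation (rdbk_state A b T S (Suc k)) x_err
      \<le> measure_pmf.expectation ?M (\<lambda>s. rate * x_err s + rate' * z_err s / \<alpha>)"
    unfolding rdbk_state_Suc using rdbk_state_finite_admissible finite_set_pmf_step expectation_step_x_err
    by (intro expectation_bind_le) auto
  also have "\<dots> = rate * measure_pmf.expectation ?M x_err + rate' * measure_pmf.expectation ?M z_err / \<alpha>"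
    by (subst Bochner_Integration.integral_add[OF int int]) simp
  also have "\<dots> \<le> rate * measure_pmf.expectation ?M x_err + rate' * (rate' ^ k * z_err (0\<^sub>v d, b)) / \<alpha>"
    using expectation_z_err[of k] col_paving_facts(4) alpha_pos
    by (intro add_left_mono divide_right_mono mult_left_mono) auto
  finally show ?thesis by simp
qed

lemma expectation_x_err:
  "measure_pmf.expectation (rdbk_state A b T S N) x_err \<le> rate ^ N * x_err (0\<^sub>v d, b)
    + (rate ^ (N div 2) + rate' ^ (N div 2)) * (z_err (0\<^sub>v d, b) / (\<alpha> * (1 - rate)))"
proof -
  have "0 \<le> z_err (0\<^sub>v d, b) / \<alpha>" using alpha_pos scalar_prod_self_nonneg by (simp add: z_err_def)
  from geometric_perturbation_bound[of rate rate' _ "\<lambda>k. measure_pmf.expectation (rdbk_state A b T S k) x_err",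
      OF row_paving_facts(4,5) col_paving_facts(4) less_imp_le[OF col_paving_facts(5)] this expectation_x_err_Suc, of N]
  show ?thesis using A by simp
qed

end

theorem theorem1:
  fixes A :: "real mat" and b x0 x_LS b_R :: "real vec"
    and n d N p p' :: nat and \<alpha> \<beta> \<alpha>' \<beta>' \<gamma> \<gamma>' :: real
    and \<S> \<T> :: "nat set set"
  assumes A: "A \<in> carrier_mat n d" and A_nonzero: "A \<noteq> 0\<^sub>m n d"
    and b: "b \<in> carrier_vec n"
    and cols: "col_paving A p' \<alpha>' \<beta>' \<T>"
    and rows: "row_paving A p \<alpha> \<beta> \<S>" and alpha_pos: "\<alpha> > 0"
  defines "x0 \<equiv> 0\<^sub>v d"
    and "x_LS \<equiv> pinv A *\<^sub>v b"
    and "b_R \<equiv> A *\<^sub>v (pinv A *\<^sub>v b)"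
    and "\<gamma> \<equiv> 1 - (sigma_min A)\<^sup>2 / (real p * \<beta>)"
    and "\<gamma>' \<equiv> 1 - (sigma_min A)\<^sup>2 / (real p' * \<beta>')"
  shows "measure_pmf.expectation (rdbk A b \<T> \<S> N) (\<lambda>x. (l2norm (x - x_LS))\<^sup>2)
           \<le> \<gamma> ^ N * (l2norm (x0 - x_LS))\<^sup>2
             + (\<gamma> ^ (N div 2) + \<gamma>' ^ (N div 2)) * ((l2norm b_R)\<^sup>2 / (\<alpha> * (1 - \<gamma>)))"
proof -
  interpret double_block_kaczmarz A b n d p p' \<alpha> \<beta> \<alpha>' \<beta>' \<S> \<T>
    by unfold_locales (fact A A_nonzero b cols rows alpha_pos)+
  have xls: "xls = x_LS" by (simp add: xls_def x_LS_def)
  \<comment> \<open>The initial \<open>z\<close> is \<open>b\<close>, so its error is the projection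
    of \<open>b\<close> onto the range, whose norm enters the bound.\<close>
  have "b - bperp = b_R"
    unfolding bperp_def xls_def b_R_def using b A by (intro eq_vecI) auto
  then have "z_err (0\<^sub>v d, b) = (l2norm b_R)\<^sup>2" by (simp add: z_err_def l2norm_squared)
  moreover have "x_err = (\<lambda>s. (l2norm (fst s - x_LS))\<^sup>2)" by (simp add: fun_eq_iff x_err_def l2norm_squared xls)
  moreover have "rate = \<gamma>" "rate' = \<gamma>'" by (simp_all add: rate_def rate'_def \<gamma>_def \<gamma>'_def)
  ultimately show ?thesis using expectation_x_err[of N] by (simp add: rdbk_def x0_def)
qed

end
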